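(* Let $A=\sigma(R)\langle x_1,\dots,x_n\rangle$ be a skew PBW extension of a ring $R$, with standard filtration $\{F_p(A)\}$ and associated graded ring $Gr(A)$. Let $\succeq$ be a monomial order on $Mon(A)$ and let $\succeq_{gr}$ be the monomial order on $Mon(Gr(A))$ defined by $\eta(x^\alpha)\succeq_{gr}\eta(x^\beta)\Leftrightarrow x^\alpha\succeq x^\beta$. Let $I\neq0$ be a left ideal of $A$ and let $\mathcal G=\{g_i\}_{i\in J}$ be a Gröbner basis of $I$ with respect to $\succeq$. Then $\overline{\mathcal G}=\{\eta(g_i)\}_{i\in J}$ is a Gröbner basis of $Gr(I)$ with respect to $\succeq_{gr}$, consisting of homogeneous elements.
   Context: Rings are associative with $1$. A ring $A$ is a skew PBW extension of a ring $R$, written $A=\sigma(R)\langle x_1,\dots,x_n\rangle$, if: (i) $R\subseteq A$ (subring); (ii) $x_1,\dots,x_n\in A$ and $A$ is a free left $R$-module with basis $Mon(A)=\{x^\alpha=x_1^{\alpha_1}\cdots x_n^{\alpha_n}\mid \alpha\in\mathbb N^n\}$; (iii) for all $1\le i\le n$ and $r\in R\setminus\{0\}$ there is $c_{i,r}\in R\setminus\{0\}$ with $x_ir-c_{i,r}x_i\in R$; (iv) for all $1\le i,j\le n$ there is $c_{i,j}\in R\setminus\{0\}$ with $x_jx_i-c_{i,j}x_ix_j\in R+Rx_1+\cdots+Rx_n$. Put $\deg(x^\alpha)=|\alpha|=\alpha_1+\dots+\alpha_n$, $\exp(x^\alpha)=\alpha$, and for $0\ne f\in A$ let $\deg(f)$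 be the maximal degree of the monomials occurring in $f$ with nonzero coefficient. Known facts defining $\sigma^\alpha$ and $c_{\alpha,\beta}$: for $\alpha\in\mathbb N^n$, $0\ne r\in R$ there are unique $\sigma^\alpha(r)\in R\setminus\{0\}$ and $p_{\alpha,r}\in A$ with $x^\alpha r=\sigma^\alpha(r)x^\alpha+p_{\alpha,r}$ and $p_{\alpha,r}=0$ or $\deg(p_{\alpha,r})<|\alpha|$; for $\alpha,\beta\in\mathbb N^n$ there are unique $c_{\alpha,\beta}\in R$ (left invertible) and $p_{\alpha,\beta}\in A$ with $x^\alpha x^\beta=c_{\alpha,\beta}x^{\alpha+\beta}+p_{\alpha,\beta}$ and $p_{\alpha,\beta}=0$ or $\deg(p_{\alpha,\beta})<|\alpha+\beta|$. Filtration: $F_p(A)=0$ for $p\le -1$, $F_0(A)=R$, $F_p(A)=\{f\in A\mid f=0\text{ or }\deg(f)\le p\}$ for $p\ge1$; $Gr(A)=\bigoplus_{p\ge0}Gr(A)_p$ with $Gr(A)_p=F_p(A)/F_{p-1}(A)$. For $0\ne f\in A$ with $\deg(f)=p$, the principal symbol is $\eta(f)=f+F_{p-1}(A)\in Gr(A)_p$. It is known that $Gr(A)$ is again a skew PBW extension of $R$ in the variables $\eta(x_1),\dots,\eta(x_n)$, with left $R$-basis of standard monomials $Mon(Gr(A))=\{\eta(x^\alpha)=\eta(x_1)^{\alpha_1}\cdots\eta(x_n)^{\alpha_n}\}$, so all the notions here apply to $Gr(A)$ as well. A monomial order on $Mon(A)$ is a total order $\succeq$ such that: (i) $x^\beta\succeq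 x^\alpha$ implies $lm(x^\gamma x^\beta x^\lambda)\succeq lm(x^\gamma x^\alpha x^\lambda)$ for all $x^\gamma,x^\lambda\in Mon(A)$; (ii) $x^\alpha\succeq 1$ for all $\alpha$; (iii) $|\beta|>|\alpha|$ implies $x^\beta\succ x^\alpha$. Here $lm(f)$ is the $\succeq$-largest monomial occurring in $f\neq0$, and $lc(f)\in R\setminus\{0\}$ is its coefficient. For a left ideal $I$ of $A$, $Gr(I)=\bigoplus_{p\ge0}Gr(I)_p$ with $Gr(I)_p=(I\cap F_p(A))/(I\cap F_{p-1}(A))\cong ((I+F_{p-1}(A))\cap F_p(A))/F_{p-1}(A)$, viewed as a left ideal of $Gr(A)$. Gröbner basis: let $I\ne0$ be a left ideal of $A$ and $G$ a nonempty finite set of nonzero elements of $I$. $G$ is a Gröbner basis of $I$ if every $0\ne f\in I$ is reducible with respect to $G$, i.e. there exist $g_1,\dots,g_t\in G$ and $\alpha_1,\dots,\alpha_t\in\mathbb N^n$ with $\alpha_j+\exp(lm(g_j))=\exp(lm(f))$ for all $j$ (that is, $lm(g_j)\mid lm(f)$) and $lc(f)$ lies in the left ideal of $R$ generated by $\sigma^{\alpha_1}(lc(g_1))c_{\alpha_1,g_1},\dots,\sigma^{\alpha_t}(lc(g_t))c_{\alpha_t,g_t}$, where $c_{\alpha,g}:=c_{\alpha,\exp(lm(g))}$. *)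

theory Defs
  imports "HOL-Algebra.Subrings" "HOL-Algebra.QuotRing" "HOL-Algebra.Product_Groups"
begin

section \<open>Skew PBW extensions\<close>

text \<open>
  The variables $x_1,\dots,x_n$ are numbered from 0, i.e. they are the values
  \<open>x 0, \<dots>, x (n - 1)\<close> of a function; elements of $\mathbb N^n$ are functions on
  \<^typ>\<open>nat\<close> that vanish from \<open>n\<close> on.
\<close>

definition mexps :: "nat \<Rightarrow> (nat \<Rightarrow> nat) set" where
  "mexps n = {\<alpha>. \<forall>i\<ge>n. \<alpha> i = 0}"

definition mdeg :: "nat \<Rightarrow> (nat \<Rightarrow> nat) \<Rightarrow> nat" where
  "mdeg n \<alpha> = (\<Sum>i<n. \<alpha> i)"

primrec mon :: "('a, 'm) ring_scheme \<Rightarrow> nat \<Rightarrow> (nat \<Rightarrow> 'a) \<Rightarrow> (nat \<Rightarrow> nat) \<Rightarrow> 'a" where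
  "mon A 0 x \<alpha> = \<one>\<^bsub>A\<^esub>"
| "mon A (Suc n) x \<alpha> = mon A n x \<alpha> \<otimes>\<^bsub>A\<^esub> (x n [^]\<^bsub>A\<^esub> \<alpha> n)"

definition Mon :: "('a, 'm) ring_scheme \<Rightarrow> nat \<Rightarrow> (nat \<Rightarrow> 'a) \<Rightarrow> 'a set" where
  "Mon A n x = mon A n x ` mexps n"

definition coeff_families ::
    "('a, 'm) ring_scheme \<Rightarrow> 'a set \<Rightarrow> nat \<Rightarrow> ((nat \<Rightarrow> nat) \<Rightarrow> 'a) set" where
  "coeff_families A R n =
     {c. range c \<subseteq> R \<and> {\<alpha>. c \<alpha> \<noteq> \<zero>\<^bsub>A\<^esub>} \<subseteq> mexps n \<and> finite {\<alpha>. c \<alpha> \<noteq> \<zero>\<^bsub>A\<^esub>}}"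

definition left_comb ::
    "('a, 'm) ring_scheme \<Rightarrow> nat \<Rightarrow> (nat \<Rightarrow> 'a) \<Rightarrow> ((nat \<Rightarrow> nat) \<Rightarrow> 'a) \<Rightarrow> 'a" where
  "left_comb A n x c = (\<Oplus>\<^bsub>A\<^esub>\<alpha>\<in>{\<alpha>. c \<alpha> \<noteq> \<zero>\<^bsub>A\<^esub>}. c \<alpha> \<otimes>\<^bsub>A\<^esub> mon A n x \<alpha>)"

definition affine_span ::
    "('a, 'm) ring_scheme \<Rightarrow> 'a set \<Rightarrow> nat \<Rightarrow> (nat \<Rightarrow> 'a) \<Rightarrow> 'a set" where
  "affine_span A R n x =
     {s \<oplus>\<^bsub>A\<^esub> (\<Oplus>\<^bsub>A\<^esub>i\<in>{..<n}. r i \<otimes>\<^bsub>A\<^esub> x i) | s r. s \<in> R \<and> r \<in> {..<n} \<rightarrow> R}"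

text \<open>
  In \<open>free\<close> the basis is understood as the family $(x^\alpha)_{\alpha\in\mathbb N^n}$, so that
  distinct exponents give distinct monomials (unless \<open>R\<close> is trivial) and $\exp(x^\alpha)=\alpha$
  makes sense.
\<close>

locale skew_PBW = ring A + subring R A
  for A :: "('a, 'm) ring_scheme" (structure) and R :: "'a set" +
  fixes n :: nat and x :: "nat \<Rightarrow> 'a"
  assumes vars: "\<And>i. i < n \<Longrightarrow> x i \<in> carrier A"
    and free: "\<And>f. f \<in> carrier A \<Longrightarrow> \<exists>!c. c \<in> coeff_families A R n \<and> f = left_comb A n x c"
    and comm_coeff: "\<And>i r. i < n \<Longrightarrow> r \<in> R - {\<zero>} \<Longrightarrow>
          \<exists>c\<in>R - {\<zero>}. x i \<otimes> r \<ominus> c \<otimes> x i \<in> R"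
    and comm_vars: "\<And>i j. i < n \<Longrightarrow> j < n \<Longrightarrow>
          \<exists>c\<in>R - {\<zero>}. x j \<otimes> x i \<ominus> c \<otimes> (x i \<otimes> x j) \<in> affine_span A R n x"

definition coeff_of ::
    "('a, 'm) ring_scheme \<Rightarrow> 'a set \<Rightarrow> nat \<Rightarrow> (nat \<Rightarrow> 'a) \<Rightarrow> 'a \<Rightarrow> (nat \<Rightarrow> nat) \<Rightarrow> 'a" where
  "coeff_of A R n x f = (THE c. c \<in> coeff_families A R n \<and> f = left_comb A n x c)"

definition supp_of ::
    "('a, 'm) ring_scheme \<Rightarrow> 'a set \<Rightarrow> nat \<Rightarrow> (nat \<Rightarrow> 'a) \<Rightarrow> 'a \<Rightarrow> (nat \<Rightarrow> nat) set" where
  "supp_of A R n x f = {\<alpha>. coeff_of A R n x f \<alpha> \<noteq> \<zero>\<^bsub>A\<^esub>}"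

text \<open>Meaningful for nonzero arguments only.\<close>

definition pbw_deg ::
    "('a, 'm) ring_scheme \<Rightarrow> 'a set \<Rightarrow> nat \<Rightarrow> (nat \<Rightarrow> 'a) \<Rightarrow> 'a \<Rightarrow> nat" where
  "pbw_deg A R n x f = Max (mdeg n ` supp_of A R n x f)"

definition lower_deg ::
    "('a, 'm) ring_scheme \<Rightarrow> 'a set \<Rightarrow> nat \<Rightarrow> (nat \<Rightarrow> 'a) \<Rightarrow> nat \<Rightarrow> 'a set" where
  "lower_deg A R n x d = {p \<in> carrier A. p = \<zero>\<^bsub>A\<^esub> \<or> pbw_deg A R n x p < d}"

text \<open>The elements $\sigma^\alpha(r)$ (for $r \neq 0$) and $c_{\alpha,\beta}$.\<close>

definition pbw_sigma ::
    "('a, 'm) ring_scheme \<Rightarrow> 'a set \<Rightarrow> nat \<Rightarrow> (nat \<Rightarrow> 'a) \<Rightarrow> (nat \<Rightarrow> nat) \<Rightarrow> 'a \<Rightarrow> 'a" where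
  "pbw_sigma A R n x \<alpha> r =
     (THE s. s \<in> R - {\<zero>\<^bsub>A\<^esub>} \<and>
        (\<exists>p\<in>lower_deg A R n x (mdeg n \<alpha>).
           mon A n x \<alpha> \<otimes>\<^bsub>A\<^esub> r = s \<otimes>\<^bsub>A\<^esub> mon A n x \<alpha> \<oplus>\<^bsub>A\<^esub> p))"

definition madd :: "(nat \<Rightarrow> nat) \<Rightarrow> (nat \<Rightarrow> nat) \<Rightarrow> nat \<Rightarrow> nat" where
  "madd \<alpha> \<beta> = (\<lambda>i. \<alpha> i + \<beta> i)"

definition pbw_c ::
    "('a, 'm) ring_scheme \<Rightarrow> 'a set \<Rightarrow> nat \<Rightarrow> (nat \<Rightarrow> 'a) \<Rightarrow> (nat \<Rightarrow> nat) \<Rightarrow> (nat \<Rightarrow> nat) \<Rightarrow> 'a" where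
  "pbw_c A R n x \<alpha> \<beta> =
     (THE c. c \<in> R \<and> (\<exists>d\<in>R. d \<otimes>\<^bsub>A\<^esub> c = \<one>\<^bsub>A\<^esub>) \<and>
        (\<exists>p\<in>lower_deg A R n x (mdeg n (madd \<alpha> \<beta>)).
           mon A n x \<alpha> \<otimes>\<^bsub>A\<^esub> mon A n x \<beta> =
             c \<otimes>\<^bsub>A\<^esub> mon A n x (madd \<alpha> \<beta>) \<oplus>\<^bsub>A\<^esub> p))"


section \<open>Monomial orders and Groebner bases\<close>

text \<open>
  A monomial order is a relation \<open>S\<close> on \<^term>\<open>Mon A n x\<close>, where \<open>(a, b) \<in> S\<close> stands
  for $a \succeq b$.
\<close>

definition lm ::
    "('a, 'm) ring_scheme \<Rightarrow> 'a set \<Rightarrow> nat \<Rightarrow> (nat \<Rightarrow> 'a) \<Rightarrow> ('a \<times> 'a) set \<Rightarrow> 'a \<Rightarrow> 'a" where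
  "lm A R n x S f =
     (THE m. m \<in> mon A n x ` supp_of A R n x f \<and>
        (\<forall>m'\<in>mon A n x ` supp_of A R n x f. (m, m') \<in> S))"

definition mexp :: "('a, 'm) ring_scheme \<Rightarrow> nat \<Rightarrow> (nat \<Rightarrow> 'a) \<Rightarrow> 'a \<Rightarrow> nat \<Rightarrow> nat" where
  "mexp A n x m = (THE \<alpha>. \<alpha> \<in> mexps n \<and> mon A n x \<alpha> = m)"

definition lc ::
    "('a, 'm) ring_scheme \<Rightarrow> 'a set \<Rightarrow> nat \<Rightarrow> (nat \<Rightarrow> 'a) \<Rightarrow> ('a \<times> 'a) set \<Rightarrow> 'a \<Rightarrow> 'a" where
  "lc A R n x S f = coeff_of A R n x f (mexp A n x (lm A R n x S f))"

definition monomial_order ::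
    "('a, 'm) ring_scheme \<Rightarrow> 'a set \<Rightarrow> nat \<Rightarrow> (nat \<Rightarrow> 'a) \<Rightarrow> ('a \<times> 'a) set \<Rightarrow> bool" where
  "monomial_order A R n x S \<longleftrightarrow>
     linear_order_on (Mon A n x) S \<and>
     (\<forall>a\<in>Mon A n x. \<forall>b\<in>Mon A n x. \<forall>g\<in>Mon A n x. \<forall>l\<in>Mon A n x. (b, a) \<in> S \<longrightarrow>
        (lm A R n x S (g \<otimes>\<^bsub>A\<^esub> b \<otimes>\<^bsub>A\<^esub> l), lm A R n x S (g \<otimes>\<^bsub>A\<^esub> a \<otimes>\<^bsub>A\<^esub> l)) \<in> S) \<and>
     (\<forall>a\<in>Mon A n x. (a, \<one>\<^bsub>A\<^esub>) \<in> S) \<and>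
     (\<forall>\<alpha>\<in>mexps n. \<forall>\<beta>\<in>mexps n. mdeg n \<beta> > mdeg n \<alpha> \<longrightarrow>
        (mon A n x \<beta>, mon A n x \<alpha>) \<in> S \<and> mon A n x \<beta> \<noteq> mon A n x \<alpha>)"

definition left_ideal :: "'a set \<Rightarrow> ('a, 'm) ring_scheme \<Rightarrow> bool" where
  "left_ideal I A \<longleftrightarrow>
     additive_subgroup I A \<and> (\<forall>a\<in>carrier A. \<forall>i\<in>I. a \<otimes>\<^bsub>A\<^esub> i \<in> I)"

definition gen_left_ideal :: "('a, 'm) ring_scheme \<Rightarrow> 'a set \<Rightarrow> 'a set" where
  "gen_left_ideal A T = \<Inter>{I. left_ideal I A \<and> T \<subseteq> I}"

definition reducible ::
    "('a, 'm) ring_scheme \<Rightarrow> 'a set \<Rightarrow> nat \<Rightarrow> (nat \<Rightarrow> 'a) \<Rightarrow> ('a \<times> 'a) set \<Rightarrow> 'a set \<Rightarrow> 'a \<Rightarrow> bool"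
  where
  "reducible A R n x S G f \<longleftrightarrow>
     (\<exists>(t::nat) g \<alpha>. t \<ge> 1 \<and>
        (\<forall>j\<in>{1..t}. g j \<in> G \<and> \<alpha> j \<in> mexps n \<and>
           madd (\<alpha> j) (mexp A n x (lm A R n x S (g j))) = mexp A n x (lm A R n x S f)) \<and>
        lc A R n x S f \<in> gen_left_ideal (A\<lparr>carrier := R\<rparr>)
          ((\<lambda>j. pbw_sigma A R n x (\<alpha> j) (lc A R n x S (g j)) \<otimes>\<^bsub>A\<^esub>
                 pbw_c A R n x (\<alpha> j) (mexp A n x (lm A R n x S (g j)))) ` {1..t}))"

definition groebner_basis ::
    "('a, 'm) ring_scheme \<Rightarrow> 'a set \<Rightarrow> nat \<Rightarrow> (nat \<Rightarrow> 'a) \<Rightarrow> ('a \<times> 'a) set \<Rightarrow> 'a set \<Rightarrow> 'a set \<Rightarrow> bool"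
  where
  "groebner_basis A R n x S I G \<longleftrightarrow>
     skew_PBW A R n x \<and> monomial_order A R n x S \<and>
     left_ideal I A \<and> I \<noteq> {\<zero>\<^bsub>A\<^esub>} \<and>
     finite G \<and> G \<noteq> {} \<and> G \<subseteq> I - {\<zero>\<^bsub>A\<^esub>} \<and>
     (\<forall>f\<in>I - {\<zero>\<^bsub>A\<^esub>}. reducible A R n x S G f)"


section \<open>The associated graded ring\<close>

definition filt ::
    "('a, 'm) ring_scheme \<Rightarrow> 'a set \<Rightarrow> nat \<Rightarrow> (nat \<Rightarrow> 'a) \<Rightarrow> int \<Rightarrow> 'a set" where
  "filt A R n x p =
     (if p < 0 then {\<zero>\<^bsub>A\<^esub>}
      else if p = 0 then R
      else {f \<in> carrier A. f = \<zero>\<^bsub>A\<^esub> \<or> int (pbw_deg A R n x f) \<le> p})"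

definition gr_part ::
    "('a, 'm) ring_scheme \<Rightarrow> 'a set \<Rightarrow> nat \<Rightarrow> (nat \<Rightarrow> 'a) \<Rightarrow> nat \<Rightarrow> 'a set monoid" where
  "gr_part A R n x p = (A\<lparr>carrier := filt A R n x (int p)\<rparr>) A_Mod (filt A R n x (int p - 1))"

text \<open>
  Elements of $Gr(A)$ are families \<open>u\<close> with \<open>u p\<close> in $F_p(A)/F_{p-1}(A)$, almost all
  zero.  The product of $f + F_{i-1}(A)$ and $g + F_{j-1}(A)$ is $fg + F_{i+j-1}(A)$, and the
  groups \<^const>\<open>gr_part\<close> are additive groups written multiplicatively, so that the
  \<^const>\<open>finprod\<close> below is a sum of cosets.
\<close>

definition Gr ::
    "('a, 'm) ring_scheme \<Rightarrow> 'a set \<Rightarrow> nat \<Rightarrow> (nat \<Rightarrow> 'a) \<Rightarrow> (nat \<Rightarrow> 'a set) ring" where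
  "Gr A R n x =
     \<lparr>carrier = carrier (sum_group UNIV (gr_part A R n x)),
      monoid.mult = (\<lambda>u v p. finprod (gr_part A R n x p)
                 (\<lambda>i. rcoset_mult A (filt A R n x (int p - 1)) (u i) (v (p - i))) {..p}),
      one = (\<lambda>p. if p = 0 then filt A R n x (- 1) +>\<^bsub>A\<^esub> \<one>\<^bsub>A\<^esub> else filt A R n x (int p - 1)),
      zero = \<one>\<^bsub>sum_group UNIV (gr_part A R n x)\<^esub>,
      add = (\<otimes>\<^bsub>sum_group UNIV (gr_part A R n x)\<^esub>)\<rparr>"

text \<open>The homogeneous element $f + F_{p-1}(A)$ of degree \<open>p\<close>, for $f \in F_p(A)$.\<close>

definition gr_elt ::
    "('a, 'm) ring_scheme \<Rightarrow> 'a set \<Rightarrow> nat \<Rightarrow> (nat \<Rightarrow> 'a) \<Rightarrow> nat \<Rightarrow> 'a \<Rightarrow> nat \<Rightarrow> 'a set" where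
  "gr_elt A R n x p f =
     (\<lambda>q. if q = p then filt A R n x (int p - 1) +>\<^bsub>A\<^esub> f else filt A R n x (int q - 1))"

definition symb ::
    "('a, 'm) ring_scheme \<Rightarrow> 'a set \<Rightarrow> nat \<Rightarrow> (nat \<Rightarrow> 'a) \<Rightarrow> 'a \<Rightarrow> nat \<Rightarrow> 'a set" where
  "symb A R n x f = gr_elt A R n x (pbw_deg A R n x f) f"

text \<open>
  The copy of \<open>R\<close> inside $Gr(A)$, namely $F_0(A)/F_{-1}(A)$; it is the coefficient ring
  of $Gr(A)$ as a skew PBW extension.
\<close>

definition gr_base ::
    "('a, 'm) ring_scheme \<Rightarrow> 'a set \<Rightarrow> nat \<Rightarrow> (nat \<Rightarrow> 'a) \<Rightarrow> (nat \<Rightarrow> 'a set) set" where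
  "gr_base A R n x = gr_elt A R n x 0 ` R"

definition gr_vars ::
    "('a, 'm) ring_scheme \<Rightarrow> 'a set \<Rightarrow> nat \<Rightarrow> (nat \<Rightarrow> 'a) \<Rightarrow> nat \<Rightarrow> nat \<Rightarrow> 'a set" where
  "gr_vars A R n x = (\<lambda>i. symb A R n x (x i))"

definition gr_order ::
    "('a, 'm) ring_scheme \<Rightarrow> 'a set \<Rightarrow> nat \<Rightarrow> (nat \<Rightarrow> 'a) \<Rightarrow> ('a \<times> 'a) set
      \<Rightarrow> ((nat \<Rightarrow> 'a set) \<times> (nat \<Rightarrow> 'a set)) set" where
  "gr_order A R n x S =
     {(symb A R n x a, symb A R n x b) | a b. a \<in> Mon A n x \<and> b \<in> Mon A n x \<and> (a, b) \<in> S}"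

text \<open>$Gr(I)$, with components $((I+F_{p-1}(A))\cap F_p(A))/F_{p-1}(A)$ inside those of $Gr(A)$.\<close>

definition gr_ideal ::
    "('a, 'm) ring_scheme \<Rightarrow> 'a set \<Rightarrow> nat \<Rightarrow> (nat \<Rightarrow> 'a) \<Rightarrow> 'a set \<Rightarrow> (nat \<Rightarrow> 'a set) set" where
  "gr_ideal A R n x I =
     carrier (sum_group UNIV (\<lambda>p.
       (A\<lparr>carrier := (I <+>\<^bsub>A\<^esub> filt A R n x (int p - 1)) \<inter> filt A R n x (int p)\<rparr>)
         A_Mod (filt A R n x (int p - 1))))"

definition homogeneous ::
    "('a, 'm) ring_scheme \<Rightarrow> 'a set \<Rightarrow> nat \<Rightarrow> (nat \<Rightarrow> 'a) \<Rightarrow> (nat \<Rightarrow> 'a set) \<Rightarrow> bool" where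
  "homogeneous A R n x u \<longleftrightarrow>
     u \<in> carrier (Gr A R n x) \<and> (\<exists>p. \<forall>q. q \<noteq> p \<longrightarrow> u q = \<one>\<^bsub>gr_part A R n x q\<^esub>)"

end

theory Submission
  imports Defs "HOL-Algebra.UnivPoly"
begin

text \<open>
  Writing \<open>F\<^sub>p\<close> for the filtration, one has \<open>F\<^sub>p F\<^sub>q \<subseteq> F\<^sub>p\<^sub>+\<^sub>q\<close>, and \<open>x\<^sup>\<alpha> r\<close> and \<open>x\<^sup>\<alpha> x\<^sup>\<beta>\<close> equal
  \<open>\<sigma>\<^sup>\<alpha>(r) x\<^sup>\<alpha>\<close> and \<open>c\<^sub>\<alpha>\<^sub>,\<^sub>\<beta> x\<^sup>\<alpha>\<^sup>+\<^sup>\<beta>\<close> up to lower degree.  Hence in \<open>Gr(A)\<close> these identities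
  hold exactly: \<open>Gr(A)\<close> is a skew PBW extension with the same \<open>\<sigma>\<close> and \<open>c\<close>.  Since the order
  refines the degree, a nonzero element of \<open>Gr(I)\<close> has the leading term of any \<open>f \<in> I\<close> representing
  its top component, and \<open>\<eta>(g)\<close> has the leading term of \<open>g\<close>.  A reduction of \<open>f\<close> by \<open>\<G>\<close> is
  therefore, verbatim, a reduction of the given element by the symbols.
\<close>

section \<open>Exponents and monomials\<close>

text \<open>The axioms only make the constants c_{i,r} and c_{i,j} nonzero, and R may have zero
  divisors, so a product of such constants could vanish in the course of a computation. The leading
  coefficient of x^alpha x^beta survives because it is left invertible. This is extracted from
  freeness by comparing coefficients (\<open>linv_var_scalar\<close>,
  \<open>vars_commute_linv\<close>) and then carried through the inductions as \<open>linv\<close>.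
  Since \<open>pbw_sigma\<close>, \<open>pbw_c\<close>, \<open>lm\<close> and \<open>mexp\<close>
  are definite descriptions, uniqueness matters as much as existence, in A and again in Gr(A); it is
  proved once in the locale and instantiated at Gr(A). Elements of Gr(A) are handled through
  finitely supported families of representatives, which reduces statements on cosets to comparing
  coefficients. The one degenerate case is the zero ring, where all monomials coincide; a nonzero
  ideal excludes it.\<close>

definition unit_exp :: "nat \<Rightarrow> nat \<Rightarrow> nat" where
  "unit_exp i = (\<lambda>j. if j = i then 1 else 0)"

lemma unit_exp_mexps: "i < n \<Longrightarrow> unit_exp i \<in> mexps n"
  by (auto simp: unit_exp_def mexps_def)

lemma zero_mexps: "(\<lambda>_. 0) \<in> mexps n"
  by (simp add: mexps_def)

lemma madd_mexps: "\<alpha> \<in> mexps n \<Longrightarrow> \<beta> \<in> mexps n \<Longrightarrow> madd \<alpha> \<beta> \<in> mexps n"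
  by (simp add: mexps_def madd_def)

lemma madd_assoc: "madd (madd \<alpha> \<beta>) \<gamma> = madd \<alpha> (madd \<beta> \<gamma>)"
  by (simp add: madd_def add.assoc)

lemma madd_commute: "madd \<alpha> \<beta> = madd \<beta> \<alpha>"
  by (simp add: madd_def add.commute)

lemma madd_zero [simp]: "madd \<alpha> (\<lambda>_. 0) = \<alpha>" "madd (\<lambda>_. 0) \<alpha> = \<alpha>"
  by (simp_all add: madd_def)

lemma mdeg_madd [simp]: "mdeg n (madd \<alpha> \<beta>) = mdeg n \<alpha> + mdeg n \<beta>"
  by (simp add: mdeg_def madd_def sum.distrib)

lemma mdeg_zero [simp]: "mdeg n (\<lambda>_. 0) = 0"
  by (simp add: mdeg_def)

lemma mdeg_unit_exp [simp]: "i < n \<Longrightarrow> mdeg n (unit_exp i) = 1"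
  by (simp add: mdeg_def unit_exp_def)

lemma mdeg_eq_0: "\<alpha> \<in> mexps n \<Longrightarrow> mdeg n \<alpha> = 0 \<longleftrightarrow> \<alpha> = (\<lambda>_. 0)"
  by (auto simp: mdeg_def mexps_def fun_eq_iff) (metis lessThan_iff not_le)

text \<open>The least variable is the one to strip off because \<open>mon\<close> writes it
  leftmost: restoring it to the remaining exponent is then plain left multiplication.\<close>

lemma mexps_least_var:
  assumes "\<alpha> \<in> mexps n" "mdeg n \<alpha> = Suc d"
  obtains i \<beta> where "i < n" "\<beta> \<in> mexps n" "mdeg n \<beta> = d" "\<alpha> = madd \<beta> (unit_exp i)"
    "\<forall>k<i. \<beta> k = 0"
proof -
  define i where "i = (LEAST i. \<alpha> i \<noteq> 0)"
  have "\<alpha> \<noteq> (\<lambda>_. 0)" using assms(2) by auto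
  then obtain k where "\<alpha> k \<noteq> 0" by auto
  then have ai: "\<alpha> i \<noteq> 0" unfolding i_def by (rule LeastI)
  have "i < n" using ai assms(1) unfolding mexps_def by (metis (mono_tags) mem_Collect_eq not_le neq0_conv)
  define \<beta> where "\<beta> = \<alpha>(i := \<alpha> i - 1)"
  have eq: "\<alpha> = madd \<beta> (unit_exp i)"
    using ai by (auto simp: \<beta>_def madd_def unit_exp_def fun_eq_iff)
  moreover have "\<beta> \<in> mexps n" using assms(1) by (auto simp: \<beta>_def mexps_def)
  moreover have "mdeg n \<beta> = d"
    using assms(2) \<open>i < n\<close> by (subst (asm) eq) simp
  moreover have "\<forall>k<i. \<beta> k = 0"
    using not_less_Least[of _ "\<lambda>i. \<alpha> i \<noteq> 0", folded i_def] by (simp add: \<beta>_def)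
  ultimately show ?thesis using that \<open>i < n\<close> by blast
qed

context ring
begin

lemma minus_add_cancel:
  "a \<in> carrier R \<Longrightarrow> b \<in> carrier R \<Longrightarrow> a = b \<oplus> (a \<ominus> b)"
  by (simp add: a_minus_def a_lcomm[of b a] r_neg)

lemma mon_closed:
  "(\<And>i. i < n \<Longrightarrow> x i \<in> carrier R) \<Longrightarrow> mon R n x \<alpha> \<in> carrier R"
  by (induction n) auto

lemma mon_eq_one: "(\<And>i. i < n \<Longrightarrow> \<alpha> i = 0) \<Longrightarrow> mon R n x \<alpha> = \<one>"
  by (induction n) auto

text \<open>With no variable below j in the monomial, x_j already stands in its proper place at the
  left, so no commutation relation is used.\<close>

lemma mon_var_left:
  assumes "\<And>i. i < n \<Longrightarrow> x i \<in> carrier R" "j < n" "\<And>k. k < j \<Longrightarrow> \<alpha> k = 0"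
  shows "mon R n x (madd \<alpha> (unit_exp j)) = x j \<otimes> mon R n x \<alpha>"
  using assms
proof (induction n)
  case (Suc n)
  show ?case
  proof (cases "j = n")
    case True
    then have "mon R n x \<alpha> = \<one>" "mon R n x (madd \<alpha> (unit_exp j)) = \<one>"
      using Suc.prems(3) by (auto intro!: mon_eq_one simp: madd_def unit_exp_def)
    then show ?thesis
      using True Suc.prems(1)[of n] nat_pow_Suc2[of "x n" "\<alpha> n"] by (simp add: madd_def unit_exp_def)
  next
    case False
    then have "mon R n x (madd \<alpha> (unit_exp j)) = x j \<otimes> mon R n x \<alpha>"
      using Suc by auto
    then show ?thesis
      using False Suc.prems(1)[of n] Suc.prems(1)[of j] Suc.prems(2) mon_closed[of n x \<alpha>] Suc.prems(1)
      by (simp add: madd_def unit_exp_def m_assoc)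
  qed
qed auto

lemma mon_unit_exp:
  assumes "\<And>i. i < n \<Longrightarrow> x i \<in> carrier R" "j < n"
  shows "mon R n x (unit_exp j) = x j"
  using mon_var_left[of n x j "\<lambda>_. 0", OF assms] assms by (simp add: mon_eq_one)

end

section \<open>Coefficients and filtration\<close>

context skew_PBW
begin

abbreviation coef :: "'a \<Rightarrow> (nat \<Rightarrow> nat) \<Rightarrow> 'a" where
  "coef f \<equiv> coeff_of A R n x f"

abbreviation M :: "(nat \<Rightarrow> nat) \<Rightarrow> 'a" where
  "M \<alpha> \<equiv> mon A n x \<alpha>"

abbreviation F :: "int \<Rightarrow> 'a set" where
  "F p \<equiv> filt A R n x p"

lemmas R_subset = subringE(1)[OF subring_axioms]
lemmas R_zero_one [simp] = subringE(2,3)[OF subring_axioms]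
lemmas R_closed [intro] = subringE(5,6,7)[OF subring_axioms]

lemma R_carrier [simp]: "r \<in> R \<Longrightarrow> r \<in> carrier A"
  using R_subset by auto

lemma M_closed [simp]: "M \<alpha> \<in> carrier A"
  by (simp add: mon_closed vars)

lemma M_zero [simp]: "M (\<lambda>_. 0) = \<one>"
  by (simp add: mon_eq_one)

lemma M_unit_exp: "i < n \<Longrightarrow> M (unit_exp i) = x i"
  by (simp add: mon_unit_exp vars)

lemma M_var_left:
  "j < n \<Longrightarrow> (\<And>k. k < j \<Longrightarrow> \<alpha> k = 0) \<Longrightarrow> M (madd \<alpha> (unit_exp j)) = x j \<otimes> M \<alpha>"
  by (simp add: mon_var_left vars)

text \<open>Induction by prepending least variables. The step supplies the factorisation itself, so
  its users never handle the condition on smaller indices.\<close>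

lemma M_induct [consumes 1, case_names zero var]:
  assumes "\<alpha> \<in> mexps n" "P (\<lambda>_. 0)"
    and step: "\<And>i \<beta>. i < n \<Longrightarrow> \<beta> \<in> mexps n \<Longrightarrow> P \<beta> \<Longrightarrow>
      M (madd \<beta> (unit_exp i)) = x i \<otimes> M \<beta> \<Longrightarrow> P (madd \<beta> (unit_exp i))"
  shows "P \<alpha>"
  using assms(1)
proof (induction "mdeg n \<alpha>" arbitrary: \<alpha>)
  case 0
  then show ?case using assms(2) mdeg_eq_0 by metis
next
  case (Suc d)
  obtain i \<beta> where *: "i < n" "\<beta> \<in> mexps n" "mdeg n \<beta> = d" "\<alpha> = madd \<beta> (unit_exp i)" "\<forall>k<i. \<beta> k = 0"
    using mexps_least_var[OF Suc.prems Suc(2)[symmetric]] by metis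
  then show ?case using step[of i \<beta>] Suc.hyps(1) M_var_left by simp
qed

section \<open>Coordinates in the basis of standard monomials\<close>

lemma coeff_familiesD:
  assumes "c \<in> coeff_families A R n"
  shows "c \<alpha> \<in> R" "c \<alpha> \<noteq> \<zero> \<Longrightarrow> \<alpha> \<in> mexps n" "finite {\<alpha>. c \<alpha> \<noteq> \<zero>}"
  using assms by (auto simp: coeff_families_def)

lemma coeff_familiesI:
  assumes "\<And>\<alpha>. c \<alpha> \<in> R" "\<And>\<alpha>. c \<alpha> \<noteq> \<zero> \<Longrightarrow> \<alpha> \<in> B" "finite B" "B \<subseteq> mexps n"
  shows "c \<in> coeff_families A R n"
  using assms unfolding coeff_families_def by (auto intro: finite_subset[of _ B])

text \<open>\<open>left_comb\<close> sums over the exact support, which differs from family to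
  family. Sums over a common finite superset can be added and compared.\<close>

lemma left_comb_superset:
  assumes "\<And>\<alpha>. c \<alpha> \<in> R" "finite B" "\<And>\<alpha>. c \<alpha> \<noteq> \<zero> \<Longrightarrow> \<alpha> \<in> B"
  shows "left_comb A n x c = (\<Oplus>\<alpha>\<in>B. c \<alpha> \<otimes> M \<alpha>)"
  unfolding left_comb_def
  by (rule add.finprod_mono_neutral_cong_left) (use assms in auto)

lemma left_comb_closed: "c \<in> coeff_families A R n \<Longrightarrow> left_comb A n x c \<in> carrier A"
  unfolding left_comb_def by (rule finsum_closed) (simp add: Pi_def coeff_familiesD(1))

lemma coef_spec:
  assumes "f \<in> carrier A"
  shows "coef f \<in> coeff_families A R n" "left_comb A n x (coef f) = f"
  using theI'[OF free[OF assms]] unfolding coeff_of_def by auto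

lemmas coef_R [simp] = coeff_familiesD(1)[OF coef_spec(1)]
lemmas coef_mexps = coeff_familiesD(2)[OF coef_spec(1)]
lemmas coef_finite = coeff_familiesD(3)[OF coef_spec(1)]

lemma coef_left_comb:
  assumes "c \<in> coeff_families A R n"
  shows "coef (left_comb A n x c) = c"
  using free[OF left_comb_closed[OF assms]] coef_spec[OF left_comb_closed[OF assms]] assms by metis

lemma coef_eqI:
  assumes "\<And>\<alpha>. c \<alpha> \<in> R" "\<And>\<alpha>. c \<alpha> \<noteq> \<zero> \<Longrightarrow> \<alpha> \<in> B" "finite B" "B \<subseteq> mexps n"
    and "f = (\<Oplus>\<alpha>\<in>B. c \<alpha> \<otimes> M \<alpha>)"
  shows "coef f = c"
  using coef_left_comb[OF coeff_familiesI[of c B, OF assms(1-4)]] left_comb_superset[of c B] assms by simp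

lemma coef_expand:
  assumes "f \<in> carrier A" "finite B" "\<And>\<alpha>. coef f \<alpha> \<noteq> \<zero> \<Longrightarrow> \<alpha> \<in> B"
  shows "f = (\<Oplus>\<alpha>\<in>B. coef f \<alpha> \<otimes> M \<alpha>)"
  using left_comb_superset[of "coef f" B] coef_spec(2)[OF assms(1)] assms by simp

lemma coef_inject: "f \<in> carrier A \<Longrightarrow> g \<in> carrier A \<Longrightarrow> coef f = coef g \<Longrightarrow> f = g"
  using coef_spec(2) by metis

lemma coef_zero [simp]: "coef \<zero> = (\<lambda>_. \<zero>)"
  by (rule coef_eqI[where B = "{}"]) auto

lemma coef_add:
  assumes "f \<in> carrier A" "g \<in> carrier A"
  shows "coef (f \<oplus> g) \<alpha> = coef f \<alpha> \<oplus> coef g \<alpha>"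
proof -
  let ?B = "{\<alpha>. coef f \<alpha> \<noteq> \<zero>} \<union> {\<alpha>. coef g \<alpha> \<noteq> \<zero>}"
  have B: "finite ?B" "?B \<subseteq> mexps n" using assms coef_finite coef_mexps by auto
  have "(\<Oplus>\<alpha>\<in>?B. (coef f \<alpha> \<oplus> coef g \<alpha>) \<otimes> M \<alpha>) = (\<Oplus>\<alpha>\<in>?B. coef f \<alpha> \<otimes> M \<alpha> \<oplus> coef g \<alpha> \<otimes> M \<alpha>)"
    using assms by (intro finsum_cong') (auto simp: l_distr)
  also have "\<dots> = f \<oplus> g"
    using coef_expand[OF assms(1) B(1)] coef_expand[OF assms(2) B(1)] assms
    by (subst finsum_addf) auto
  finally have "coef (f \<oplus> g) = (\<lambda>\<alpha>. coef f \<alpha> \<oplus> coef g \<alpha>)"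
    using assms B by (intro coef_eqI[where B = ?B]) auto
  then show ?thesis by simp
qed

lemma coef_smult:
  assumes "r \<in> R" "f \<in> carrier A"
  shows "coef (r \<otimes> f) \<alpha> = r \<otimes> coef f \<alpha>"
proof -
  let ?B = "{\<alpha>. coef f \<alpha> \<noteq> \<zero>}"
  have B: "finite ?B" "?B \<subseteq> mexps n" using assms coef_finite coef_mexps by auto
  have "(\<Oplus>\<alpha>\<in>?B. (r \<otimes> coef f \<alpha>) \<otimes> M \<alpha>) = (\<Oplus>\<alpha>\<in>?B. r \<otimes> (coef f \<alpha> \<otimes> M \<alpha>))"
    using assms by (intro finsum_cong') (auto simp: m_assoc)
  also have "\<dots> = r \<otimes> f"
    using coef_expand[OF assms(2) B(1)] assms B(1)
    by (subst finsum_rdistr[symmetric]) auto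
  finally have "coef (r \<otimes> f) = (\<lambda>\<alpha>. r \<otimes> coef f \<alpha>)"
    using assms B by (intro coef_eqI[where B = ?B]) auto
  then show ?thesis by simp
qed

lemma coef_neg:
  assumes "f \<in> carrier A"
  shows "coef (\<ominus> f) \<alpha> = \<ominus> coef f \<alpha>"
proof -
  have "coef (f \<oplus> \<ominus> f) \<alpha> = coef f \<alpha> \<oplus> coef (\<ominus> f) \<alpha>"
    using assms by (intro coef_add) auto
  then have "coef f \<alpha> \<oplus> coef (\<ominus> f) \<alpha> = \<zero>" using assms by (simp add: r_neg)
  then show ?thesis using assms
    by (metis R_carrier a_inv_closed coef_R minus_equality a_comm)
qed

lemma coef_minus:
  "f \<in> carrier A \<Longrightarrow> g \<in> carrier A \<Longrightarrow> coef (f \<ominus> g) \<alpha> = coef f \<alpha> \<ominus> coef g \<alpha>"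
  by (simp add: a_minus_def coef_add coef_neg)

lemma coef_M: "\<alpha> \<in> mexps n \<Longrightarrow> coef (M \<alpha>) \<beta> = (if \<beta> = \<alpha> then \<one> else \<zero>)"
  by (subst coef_eqI[where B = "{\<alpha>}" and c = "\<lambda>\<beta>. if \<beta> = \<alpha> then \<one> else \<zero>"]) (auto split: if_splits)

lemma coef_term:
  "r \<in> R \<Longrightarrow> \<alpha> \<in> mexps n \<Longrightarrow> coef (r \<otimes> M \<alpha>) \<beta> = (if \<beta> = \<alpha> then r else \<zero>)"
  by (simp add: coef_smult coef_M)

lemma coef_base: "r \<in> R \<Longrightarrow> coef r \<beta> = (if \<beta> = (\<lambda>_. 0) then r else \<zero>)"
  using coef_term[of r "\<lambda>_. 0"] zero_mexps by simp

section \<open>Degree and filtration\<close>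

lemma supp_of_nonempty:
  assumes "f \<in> carrier A" "f \<noteq> \<zero>"
  shows "finite (supp_of A R n x f)" "supp_of A R n x f \<noteq> {}" "supp_of A R n x f \<subseteq> mexps n"
proof -
  show "supp_of A R n x f \<noteq> {}"
    using assms coef_inject[of f \<zero>] by (auto simp: supp_of_def fun_eq_iff)
qed (use assms coef_finite coef_mexps in \<open>auto simp: supp_of_def\<close>)

lemma pbw_deg_le_iff:
  assumes "f \<in> carrier A" "f \<noteq> \<zero>"
  shows "int (pbw_deg A R n x f) \<le> p \<longleftrightarrow> (\<forall>\<alpha>. coef f \<alpha> \<noteq> \<zero> \<longrightarrow> int (mdeg n \<alpha>) \<le> p)"
proof -
  note s = supp_of_nonempty[OF assms]
  have "pbw_deg A R n x f \<in> mdeg n ` supp_of A R n x f"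
    unfolding pbw_deg_def using s by (intro Max_in) auto
  moreover have "mdeg n \<alpha> \<le> pbw_deg A R n x f" if "\<alpha> \<in> supp_of A R n x f" for \<alpha>
    unfolding pbw_deg_def using s that by (intro Max_ge) auto
  ultimately show ?thesis by (fastforce simp: supp_of_def)
qed

text \<open>One description by coefficients replaces the three cases of the definition, and it
  avoids \<open>pbw_deg\<close> of zero, a maximum over the empty set. For negative p no degree
  qualifies; for p = 0 only the exponent 0 remains.\<close>

lemma filt_iff:
  "f \<in> F p \<longleftrightarrow> f \<in> carrier A \<and> (\<forall>\<alpha>. coef f \<alpha> \<noteq> \<zero> \<longrightarrow> int (mdeg n \<alpha>) \<le> p)"
proof -
  consider "p < 0" | "p = 0" | "p > 0" by linarith
  then show ?thesis
  proof cases
    case 1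
    then have "int (mdeg n \<alpha>) \<le> p \<longleftrightarrow> False" for \<alpha> by simp
    then show ?thesis using 1 coef_inject[of f \<zero>] by (auto simp: filt_def fun_eq_iff)
  next
    case 2
    have "f \<in> R" if f: "f \<in> carrier A" "\<forall>\<alpha>. coef f \<alpha> \<noteq> \<zero> \<longrightarrow> int (mdeg n \<alpha>) \<le> 0"
    proof -
      have "f = (\<Oplus>\<alpha>\<in>{\<lambda>_. 0}. coef f \<alpha> \<otimes> M \<alpha>)"
        by (rule coef_expand) (use f coef_mexps mdeg_eq_0 in auto)
      also have "\<dots> \<in> R" using f(1) by simp
      finally show ?thesis .
    qed
    moreover have "f \<in> carrier A \<and> (\<forall>\<alpha>. coef f \<alpha> \<noteq> \<zero> \<longrightarrow> int (mdeg n \<alpha>) \<le> 0)" if "f \<in> R"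
      using that by (simp add: coef_base)
    ultimately show ?thesis using 2 by (simp only: filt_def less_irrefl if_False if_True refl) blast
  next
    case 3
    then show ?thesis using pbw_deg_le_iff[of f p] by (cases "f = \<zero>") (auto simp: filt_def)
  qed
qed

lemma filt_carrier [simp]: "f \<in> F p \<Longrightarrow> f \<in> carrier A"
  by (simp add: filt_iff)

lemma filt_zero [simp]: "\<zero> \<in> F p"
  by (simp add: filt_iff)

lemma filt_add: "f \<in> F p \<Longrightarrow> g \<in> F p \<Longrightarrow> f \<oplus> g \<in> F p"
  unfolding filt_iff by (auto simp: coef_add) (metis l_zero zero_closed)

lemma filt_neg: "f \<in> F p \<Longrightarrow> \<ominus> f \<in> F p"
  unfolding filt_iff by (auto simp: coef_neg)

lemma filt_minus: "f \<in> F p \<Longrightarrow> g \<in> F p \<Longrightarrow> f \<ominus> g \<in> F p"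
  by (simp add: a_minus_def filt_add filt_neg)

lemma filt_smult: "r \<in> R \<Longrightarrow> f \<in> F p \<Longrightarrow> r \<otimes> f \<in> F p"
  unfolding filt_iff by (auto simp: coef_smult) (metis R_carrier r_null)

lemma filt_mono: "f \<in> F p \<Longrightarrow> p \<le> q \<Longrightarrow> f \<in> F q"
  unfolding filt_iff by fastforce

lemma filt_M: "\<alpha> \<in> mexps n \<Longrightarrow> int (mdeg n \<alpha>) \<le> p \<Longrightarrow> M \<alpha> \<in> F p"
  by (auto simp: filt_iff coef_M)

lemma filt_base: "r \<in> R \<Longrightarrow> 0 \<le> p \<Longrightarrow> r \<in> F p"
  by (auto simp: filt_iff coef_base)

lemma filt_0 [simp]: "F 0 = R"
  by (simp add: filt_def)

lemma filt_neg_index: "p < 0 \<Longrightarrow> F p = {\<zero>}"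
  by (simp add: filt_def)

lemma filt_finsum: "finite B \<Longrightarrow> (\<And>b. b \<in> B \<Longrightarrow> h b \<in> F p) \<Longrightarrow> finsum A h B \<in> F p"
proof (induction rule: finite_induct)
  case (insert b B)
  have "h b \<in> F p" "\<forall>b\<in>B. h b \<in> F p" using insert.prems by auto
  then show ?case using insert.hyps insert.IH insert.prems by (subst finsum_insert) (simp_all add: filt_add Pi_def filt_carrier[of _ p])
qed auto

lemma filt_additive_subgroup: "additive_subgroup (F p) A"
proof (rule additive_subgroupI)
  show "subgroup (F p) (add_monoid A)"
    by (rule add.subgroupI) (use filt_zero[of p] in \<open>auto simp: filt_add filt_neg simp del: filt_zero\<close>)
qed

text \<open>Additive claims on the filtration reduce to single terms. The summands in the
  \<open>add\<close> case are again in F p, so the degree bound is available throughout.\<close>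

lemma filt_induct [consumes 1, case_names zero add monomial]:
  assumes "f \<in> F p" "P \<zero>"
    and add: "\<And>g h. g \<in> F p \<Longrightarrow> h \<in> F p \<Longrightarrow> P g \<Longrightarrow> P h \<Longrightarrow> P (g \<oplus> h)"
    and monomial: "\<And>r \<alpha>. r \<in> R \<Longrightarrow> \<alpha> \<in> mexps n \<Longrightarrow> int (mdeg n \<alpha>) \<le> p \<Longrightarrow> P (r \<otimes> M \<alpha>)"
  shows "P f"
proof -
  let ?h = "\<lambda>\<alpha>. coef f \<alpha> \<otimes> M \<alpha>"
  have h: "P (?h \<alpha>) \<and> ?h \<alpha> \<in> F p" if "coef f \<alpha> \<noteq> \<zero>" for \<alpha>
    using assms(1) that coef_mexps[of f \<alpha>] monomial by (auto simp: filt_iff coef_term)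
  have "finite B \<Longrightarrow> B \<subseteq> {\<alpha>. coef f \<alpha> \<noteq> \<zero>} \<Longrightarrow> P (finsum A ?h B) \<and> finsum A ?h B \<in> F p" for B
  proof (induction rule: finite_induct)
    case (insert b B)
    then have "finsum A ?h (insert b B) = ?h b \<oplus> finsum A ?h B"
      using assms(1) by (intro finsum_insert) auto
    then show ?case using insert h[of b] by (auto intro: add filt_add)
  qed (use assms(2) in auto)
  from this[OF coef_finite subset_refl] show ?thesis
    using coef_expand[of f "{\<alpha>. coef f \<alpha> \<noteq> \<zero>}"] coef_finite assms(1) by auto
qed

section \<open>Left-invertible structure constants\<close>

definition linv :: "'a \<Rightarrow> bool" where
  "linv c \<longleftrightarrow> c \<in> R \<and> (\<exists>d\<in>R. d \<otimes> c = \<one>)"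

lemma linv_R [simp]: "linv c \<Longrightarrow> c \<in> R"
  by (simp add: linv_def)

lemma linv_one: "linv \<one>"
  unfolding linv_def by (intro conjI bexI[of _ \<one>]) simp_all

text \<open>Nonzero elements of R need not have a nonzero product, whereas left-invertible ones are
  closed under products. Hence this is the property that can be carried along an induction.\<close>

lemma linv_mult:
  assumes "linv a" "linv b"
  shows "linv (a \<otimes> b)"
proof -
  obtain c d where cd: "c \<in> R" "c \<otimes> a = \<one>" "d \<in> R" "d \<otimes> b = \<one>" "a \<in> R" "b \<in> R"
    using assms unfolding linv_def by blast
  have "(d \<otimes> c) \<otimes> (a \<otimes> b) = d \<otimes> ((c \<otimes> a) \<otimes> b)"
    using cd(1,3,5,6) by (simp add: m_assoc)
  then show ?thesis unfolding linv_def using cd by (intro conjI bexI[of _ "d \<otimes> c"]) auto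
qed

lemma var_scalar_ex:
  assumes "i < n" "r \<in> R"
  shows "\<exists>s\<in>R. \<exists>d\<in>R. x i \<otimes> r = s \<otimes> x i \<oplus> d \<and> (r \<noteq> \<zero> \<longrightarrow> s \<noteq> \<zero>)"
proof (cases "r = \<zero>")
  case False
  then obtain c where c: "c \<in> R" "c \<noteq> \<zero>" "x i \<otimes> r \<ominus> c \<otimes> x i \<in> R"
    using comm_coeff[of i r] assms by auto
  have "x i \<otimes> r = c \<otimes> x i \<oplus> (x i \<otimes> r \<ominus> c \<otimes> x i)"
    using assms c vars[of i] by (intro minus_add_cancel) auto
  then show ?thesis using c by blast
qed (use assms vars in \<open>auto intro!: bexI[of _ \<zero>]\<close>)

lemma coef_var_term:
  assumes "i < n" "s \<in> R" "d \<in> R"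
  shows "coef (s \<otimes> x i \<oplus> d) (unit_exp i) = s"
proof -
  have "unit_exp i \<noteq> (\<lambda>_. 0)" by (auto simp: unit_exp_def fun_eq_iff)
  then have "coef (s \<otimes> M (unit_exp i) \<oplus> d) (unit_exp i) = s"
    using assms unit_exp_mexps by (simp add: coef_add coef_term coef_base)
  then show ?thesis using assms by (simp add: M_unit_exp)
qed

text \<open>If r' r = 1, then moving x_i to the right past r' and then past r rewrites x_i = x_i r'
  r as (s' s) x_i plus an element of R. Freeness compares the coefficients of x_i and gives s' s =
  1.\<close>

lemma linv_var_scalar:
  assumes i: "i < n" and "linv r" and s: "s \<in> R" "d \<in> R" "x i \<otimes> r = s \<otimes> x i \<oplus> d"
  shows "linv s"
proof -
  obtain r' where r': "r \<in> R" "r' \<in> R" "r' \<otimes> r = \<one>" using assms(2) unfolding linv_def by auto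
  obtain s' d' where s': "s' \<in> R" "d' \<in> R" "x i \<otimes> r' = s' \<otimes> x i \<oplus> d'"
    using var_scalar_ex[OF i r'(2)] by auto
  note v = vars[OF i]
  have "\<one> \<otimes> x i \<oplus> \<zero> = x i \<otimes> (r' \<otimes> r)" using r' v by simp
  also have "\<dots> = (x i \<otimes> r') \<otimes> r" using r' v by (simp add: m_assoc)
  also have "\<dots> = (s' \<otimes> s) \<otimes> x i \<oplus> (s' \<otimes> d \<oplus> d' \<otimes> r)"
    using s s' r' v by (simp add: l_distr r_distr m_assoc a_assoc)
  finally have "coef (\<one> \<otimes> x i \<oplus> \<zero>) (unit_exp i) = coef ((s' \<otimes> s) \<otimes> x i \<oplus> (s' \<otimes> d \<oplus> d' \<otimes> r)) (unit_exp i)"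
    by simp
  then have "s' \<otimes> s = \<one>" using i s(1,2) s'(1,2) r'(1,2) by (simp add: coef_var_term R_closed del: l_one)
  then show ?thesis unfolding linv_def using s s' by auto
qed

lemma affine_span_filt: "affine_span A R n x \<subseteq> F 1"
proof
  fix f assume "f \<in> affine_span A R n x"
  then obtain s r where f: "s \<in> R" "r \<in> {..<n} \<rightarrow> R" "f = s \<oplus> (\<Oplus>i\<in>{..<n}. r i \<otimes> x i)"
    unfolding affine_span_def by auto
  have "r i \<otimes> x i \<in> F 1" if "i < n" for i
    using that f(2) filt_smult[of "r i" "M (unit_exp i)" 1] filt_M[of "unit_exp i" 1] unit_exp_mexps
    by (auto simp: M_unit_exp)
  then show "f \<in> F 1"unfolding f(3) by (intro filt_add[OF filt_base[OF f(1)]] filt_finsum) simp_all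
qed

lemma vars_commute:
  assumes "i < n" "j < n"
  shows "\<exists>c\<in>R. \<exists>a\<in>F 1. x j \<otimes> x i = c \<otimes> (x i \<otimes> x j) \<oplus> a"
proof -
  obtain c where c: "c \<in> R" "x j \<otimes> x i \<ominus> c \<otimes> (x i \<otimes> x j) \<in> F 1"
    using comm_vars[OF assms] affine_span_filt by auto
  have "x j \<otimes> x i = c \<otimes> (x i \<otimes> x j) \<oplus> (x j \<otimes> x i \<ominus> c \<otimes> (x i \<otimes> x j))"
    using assms c vars by (intro minus_add_cancel) auto
  then show ?thesis using c by blast
qed

text \<open>Commuting \<open>x\<^sub>i\<close> and \<open>x\<^sub>j\<close> twice shows that the two structure constants multiply to 1.\<close>

lemma vars_commute_linv:
  assumes "i < j" "j < n"
  shows "\<exists>c a. linv c \<and> a \<in> F 1 \<and> x j \<otimes> x i = c \<otimes> (x i \<otimes> x j) \<oplus> a"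
proof -
  have ij: "i < n" "j < n" using assms by auto
  note v = vars[OF ij(1)] vars[OF ij(2)]
  obtain c a where c: "c \<in> R" "a \<in> F 1" "x j \<otimes> x i = c \<otimes> (x i \<otimes> x j) \<oplus> a"
    using vars_commute[OF ij] by auto
  obtain d b where d: "d \<in> R" "b \<in> F 1" "x i \<otimes> x j = d \<otimes> (x j \<otimes> x i) \<oplus> b"
    using vars_commute[OF ij(2,1)] by auto
  \<comment> \<open>Here i < j matters: x_i x_j is then a standard monomial, hence a basis element
    whose coefficient can be read off.\<close>
  define \<epsilon> where "\<epsilon> = madd (unit_exp j) (unit_exp i)"
  have \<epsilon>: "\<epsilon> \<in> mexps n" "mdeg n \<epsilon> = 2"
    using ij by (auto simp: \<epsilon>_def intro!: madd_mexps unit_exp_mexps)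
  have M: "M \<epsilon> = x i \<otimes> x j"
    unfolding \<epsilon>_def using assms ij
    using M_var_left[of i "unit_exp j"] by (simp add: M_unit_exp) (simp add: unit_exp_def)
  have "M \<epsilon> = (d \<otimes> c) \<otimes> M \<epsilon> \<oplus> (d \<otimes> a \<oplus> b)"
  proof -
    have "x i \<otimes> x j = d \<otimes> (c \<otimes> (x i \<otimes> x j) \<oplus> a) \<oplus> b" using c(3) d(3) by simp
    then show ?thesis unfolding M using c(1,2) d(1,2) v by (simp add: r_distr m_assoc a_assoc)
  qed
  then have "coef (M \<epsilon>) \<epsilon> = coef ((d \<otimes> c) \<otimes> M \<epsilon> \<oplus> (d \<otimes> a \<oplus> b)) \<epsilon>" by simp
  moreover have "coef (d \<otimes> a \<oplus> b) \<epsilon> = \<zero>"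
    using filt_add[OF filt_smult[OF d(1) c(2)] d(2)] \<epsilon>(2) unfolding filt_iff by auto
  ultimately have "\<one> = d \<otimes> c"
    using c d \<epsilon> by (simp add: coef_add coef_M coef_term)
  then show ?thesis using c d unfolding linv_def by metis
qed

section \<open>Products respect the filtration\<close>

lemma var_times_term:
  assumes "i < n" "r \<in> R" "\<alpha> \<in> mexps n" "int (mdeg n \<alpha>) \<le> p" "x i \<otimes> M \<alpha> \<in> F (p + 1)"
  shows "x i \<otimes> (r \<otimes> M \<alpha>) \<in> F (p + 1)"
proof -
  obtain s d where s: "s \<in> R" "d \<in> R" "x i \<otimes> r = s \<otimes> x i \<oplus> d"
    using var_scalar_ex[OF assms(1,2)] by auto
  have "x i \<otimes> (r \<otimes> M \<alpha>) = s \<otimes> (x i \<otimes> M \<alpha>) \<oplus> d \<otimes> M \<alpha>"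
    using s assms vars by (simp add: m_assoc[symmetric] l_distr)
  then show ?thesis using assms s by (auto intro!: filt_add filt_smult filt_M)
qed

text \<open>The bound for monomials is a hypothesis because \<open>var_times_M\<close> calls this
  lemma inside its own induction, where the bound is known only in smaller degrees.\<close>

lemma var_times_filt_aux:
  assumes "i < n" "f \<in> F p"
    and "\<And>\<alpha>. \<alpha> \<in> mexps n \<Longrightarrow> int (mdeg n \<alpha>) \<le> p \<Longrightarrow> x i \<otimes> M \<alpha> \<in> F (int (mdeg n \<alpha>) + 1)"
  shows "x i \<otimes> f \<in> F (p + 1)"
  using assms(2)
proof (induction rule: filt_induct)
  case zero
  then show ?case using vars assms(1) by simp
next
  case (add g h)
  then show ?case using vars assms(1) by (auto simp: r_distr intro: filt_add)
next
  case (monomial r \<alpha>)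
  then show ?case using var_times_term[OF assms(1) monomial] assms(3) filt_mono by fastforce
qed

lemma scalar_var_M:
  assumes "i < n" "c \<in> R" "\<alpha> \<in> mexps n"
  shows "c \<otimes> M (madd \<alpha> (unit_exp i)) \<in> F (int (mdeg n \<alpha>) + 1)"
  using assms by (intro filt_smult filt_M madd_mexps unit_exp_mexps) auto

text \<open>Induction on the degree. If x_i may stand first, the product is already standard.
  Otherwise the leftmost variable x_j of x^alpha has j < i; swapping x_i with x_j reduces to x_i
  x^beta with beta of smaller degree, and x_j is then put back in front. All corrections stay in
  degree at most |alpha|, and the leading coefficient is a product of left-invertible
  elements.\<close>

lemma var_times_M:
  assumes "i < n" "\<alpha> \<in> mexps n"
  shows "\<exists>c p. linv c \<and> p \<in> F (int (mdeg n \<alpha>)) \<and> x i \<otimes> M \<alpha> = c \<otimes> M (madd \<alpha> (unit_exp i)) \<oplus> p"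
  using assms
proof (induction "mdeg n \<alpha>" arbitrary: i \<alpha> rule: less_induct)
  case less
  note i = less.prems(1)
  show ?case
  proof (cases "\<forall>k<i. \<alpha> k = 0")
    case True
    then have "x i \<otimes> M \<alpha> = \<one> \<otimes> M (madd \<alpha> (unit_exp i)) \<oplus> \<zero>"
      using M_var_left[OF i, of \<alpha>] i vars by simp
    then show ?thesis using linv_one filt_zero by blast
  next
    case False
    then have "mdeg n \<alpha> \<noteq> 0" using mdeg_eq_0[OF less.prems(2)] by auto
    then obtain d where d: "mdeg n \<alpha> = Suc d" using not0_implies_Suc by blast
    obtain j \<beta> where j: "j < n" "\<beta> \<in> mexps n" "mdeg n \<beta> = d" "\<alpha> = madd \<beta> (unit_exp j)" "\<forall>k<j. \<beta> k = 0"
      using mexps_least_var[OF less.prems(2) d] by metis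
    have "j < i"
    proof (rule ccontr)
      assume "\<not> j < i"
      then have "\<forall>k<i. \<alpha> k = 0" using j(4,5) by (auto simp: madd_def unit_exp_def)
      then show False using False by simp
    qed
    \<comment> \<open>The induction hypothesis, extended from monomials to filtered elements. The
      limit d is one below the degree of alpha.\<close>
    have step: "x k \<otimes> f \<in> F (p + 1)" if "k < n" "f \<in> F p" "p \<le> int d" for k f p
    proof (rule var_times_filt_aux[OF that(1,2)])
      fix \<gamma> assume \<gamma>: "\<gamma> \<in> mexps n" "int (mdeg n \<gamma>) \<le> p"
      then obtain c q where "linv c" "q \<in> F (int (mdeg n \<gamma>))"
        "x k \<otimes> M \<gamma> = c \<otimes> M (madd \<gamma> (unit_exp k)) \<oplus> q"
        using less.hyps[of \<gamma> k] \<open>k < n\<close> \<open>p \<le> int d\<close> d by force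
      then show "x k \<otimes> M \<gamma> \<in> F (int (mdeg n \<gamma>) + 1)"
        using that \<gamma> scalar_var_M by (auto intro!: filt_add intro: filt_mono)
    qed
    obtain c a where c: "linv c" "a \<in> F 1" "x i \<otimes> x j = c \<otimes> (x j \<otimes> x i) \<oplus> a"
      using vars_commute_linv[OF \<open>j < i\<close> i] by auto
    obtain c' p where c': "linv c'" "p \<in> F (int d)" "x i \<otimes> M \<beta> = c' \<otimes> M (madd \<beta> (unit_exp i)) \<oplus> p"
      using less.hyps[of \<beta> i] j d i by auto
    have c'R: "c' \<in> R" using c' by simp
    obtain s e where s: "s \<in> R" "e \<in> R" "x j \<otimes> c' = s \<otimes> x j \<oplus> e"
      using var_scalar_ex[OF j(1) c'R] by auto
    have "linv s" using linv_var_scalar[OF j(1) c'(1) s] .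
    \<comment> \<open>Every variable of this exponent still has index at least j, as j < i and j is
      least in alpha. So multiplying by x_j on the left yields a standard monomial.\<close>
    define \<beta>' where "\<beta>' = madd \<beta> (unit_exp i)"
    have \<beta>': "\<beta>' \<in> mexps n" "mdeg n \<beta>' = Suc d" "\<forall>k<j. \<beta>' k = 0"
      using j i \<open>j < i\<close> by (auto simp: \<beta>'_def madd_mexps unit_exp_mexps) (auto simp: madd_def unit_exp_def)
    have sum: "madd \<beta>' (unit_exp j) = madd \<alpha> (unit_exp i)"
      unfolding \<beta>'_def j(4) by (auto simp: madd_def fun_eq_iff)
    have xM: "x j \<otimes> M \<beta>' = M (madd \<alpha> (unit_exp i))"
      using M_var_left[OF j(1), of \<beta>'] \<beta>'(3) sum by simp
    \<comment> \<open>The correction a of the swap is a combination of 1 and the variables; a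
      product of a variable with x^beta is covered by \<open>step\<close>.\<close>
    have aM: "a \<otimes> M \<beta> \<in> F (int (Suc d))"
      using c(2)
    proof (induction rule: filt_induct)
      case (add g h)
      then show ?case by (auto simp: l_distr intro: filt_add)
    next
      case (monomial r \<gamma>)
      have "M \<gamma> \<otimes> M \<beta> \<in> F (int (Suc d))"
      proof (cases "mdeg n \<gamma> = 0")
        case True
        then show ?thesis using monomial mdeg_eq_0[of \<gamma>] j by (auto intro!: filt_M)
      next
        case False
        then have "mdeg n \<gamma> = Suc 0" using monomial by auto
        then obtain k \<delta> where k: "k < n" "\<delta> \<in> mexps n" "mdeg n \<delta> = 0" "\<gamma> = madd \<delta> (unit_exp k)"
          using mexps_least_var[OF monomial(2)] by metis
        then have "\<gamma> = unit_exp k" using mdeg_eq_0 by simp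
        then show ?thesis using step[OF k(1) filt_M[OF j(2)], of "int d"] j(3) k by (simp add: M_unit_exp add.commute)
      qed
      then show ?case using monomial by (simp add: m_assoc filt_smult)
    qed auto
    have v: "x i \<in> carrier A" "x j \<in> carrier A" using i j vars by auto
    have cR: "c \<in> R" using c by simp
    have "x i \<otimes> M \<alpha> = (x i \<otimes> x j) \<otimes> M \<beta>"
      using M_var_left[OF j(1), of \<beta>] j v by (simp add: m_assoc)
    also have "\<dots> = c \<otimes> (x j \<otimes> (x i \<otimes> M \<beta>)) \<oplus> a \<otimes> M \<beta>"
      using c cR v by (simp add: l_distr m_assoc)
    also have "x j \<otimes> (x i \<otimes> M \<beta>) = (x j \<otimes> c') \<otimes> M \<beta>' \<oplus> x j \<otimes> p"
      using c' c'R v unfolding c'(3) by (simp add: \<beta>'_def m_assoc r_distr)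
    also have "(x j \<otimes> c') \<otimes> M \<beta>' = s \<otimes> M (madd \<alpha> (unit_exp i)) \<oplus> e \<otimes> M \<beta>'"
      unfolding s(3) using s v xM by (simp add: l_distr m_assoc)
    also have "c \<otimes> (s \<otimes> M (madd \<alpha> (unit_exp i)) \<oplus> e \<otimes> M \<beta>' \<oplus> x j \<otimes> p) \<oplus> a \<otimes> M \<beta>
      = (c \<otimes> s) \<otimes> M (madd \<alpha> (unit_exp i)) \<oplus> (c \<otimes> (e \<otimes> M \<beta>' \<oplus> x j \<otimes> p) \<oplus> a \<otimes> M \<beta>)"
      using s c cR v c'(2) by (simp add: r_distr m_assoc a_assoc)
    finally have eq: "x i \<otimes> M \<alpha> = (c \<otimes> s) \<otimes> M (madd \<alpha> (unit_exp i)) \<oplus> (c \<otimes> (e \<otimes> M \<beta>' \<oplus> x j \<otimes> p) \<oplus> a \<otimes> M \<beta>)" .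
    have "c \<otimes> (e \<otimes> M \<beta>' \<oplus> x j \<otimes> p) \<oplus> a \<otimes> M \<beta> \<in> F (int (mdeg n \<alpha>))"
      using cR s \<beta>' aM d step[OF j(1) c'(2)] by (auto intro!: filt_add filt_smult filt_M simp: add.commute)
    then show ?thesis using eq linv_mult[OF c(1) \<open>linv s\<close>] by blast
  qed
qed

lemma var_times_filt: "i < n \<Longrightarrow> f \<in> F p \<Longrightarrow> x i \<otimes> f \<in> F (p + 1)"
proof (rule var_times_filt_aux)
  fix \<alpha> assume *: "i < n" "\<alpha> \<in> mexps n"
  then obtain c p where "linv c" "p \<in> F (int (mdeg n \<alpha>))"
    "x i \<otimes> M \<alpha> = c \<otimes> M (madd \<alpha> (unit_exp i)) \<oplus> p" using var_times_M[OF *] by auto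
  then show "x i \<otimes> M \<alpha> \<in> F (int (mdeg n \<alpha>) + 1)"
    using * scalar_var_M by (auto intro!: filt_add intro: filt_mono)
qed auto

lemma M_times_filt:
  assumes "\<alpha> \<in> mexps n" "f \<in> F p"
  shows "M \<alpha> \<otimes> f \<in> F (int (mdeg n \<alpha>) + p)"
  using assms(1)
proof (induction rule: M_induct)
  case (var i \<beta>)
  then have "M (madd \<beta> (unit_exp i)) \<otimes> f = x i \<otimes> (M \<beta> \<otimes> f)"
    using vars assms(2) by (simp add: m_assoc)
  moreover have "x i \<otimes> (M \<beta> \<otimes> f) \<in> F (int (mdeg n \<beta>) + p + 1)"
    using var by (intro var_times_filt)
  ultimately show ?case using var(1) by (simp add: ac_simps)
qed (use assms in auto)

lemma filt_mult:
  assumes "f \<in> F p" "g \<in> F q"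
  shows "f \<otimes> g \<in> F (p + q)"
  using assms(1)
proof (induction rule: filt_induct)
  case (add f h)
  then show ?case using assms(2) by (auto simp: l_distr intro: filt_add)
next
  case (monomial r \<alpha>)
  have "M \<alpha> \<otimes> g \<in> F (p + q)"
    by (rule filt_mono[OF M_times_filt[OF monomial(2) assms(2)]]) (use monomial in simp)
  then have "r \<otimes> (M \<alpha> \<otimes> g) \<in> F (p + q)"
    by (rule filt_smult[OF monomial(1)])
  then show ?case using monomial assms(2) by (simp add: m_assoc)
qed (use assms in auto)

section \<open>The structure constants c and sigma\<close>

lemma M_mult:
  assumes "\<alpha> \<in> mexps n" "\<beta> \<in> mexps n"
  shows "\<exists>c p. linv c \<and> p \<in> F (int (mdeg n (madd \<alpha> \<beta>)) - 1) \<and> M \<alpha> \<otimes> M \<beta> = c \<otimes> M (madd \<alpha> \<beta>) \<oplus> p"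
  using assms(1)
proof (induction rule: M_induct)
  case zero
  show ?case by (rule exI[of _ \<one>], rule exI[of _ \<zero>]) (simp add: linv_one)
next
  case (var i \<gamma>)
  then obtain c p where c: "linv c" "p \<in> F (int (mdeg n (madd \<gamma> \<beta>)) - 1)"
    "M \<gamma> \<otimes> M \<beta> = c \<otimes> M (madd \<gamma> \<beta>) \<oplus> p" by auto
  have cR: "c \<in> R" using c by simp
  note v = vars[OF var(1)]
  obtain s e where s: "s \<in> R" "e \<in> R" "x i \<otimes> c = s \<otimes> x i \<oplus> e"
    using var_scalar_ex[OF var(1) cR] by auto
  \<comment> \<open>Prepending x_i replaces the old constant c by s on its way through. Left
    invertibility survives this, so the new constant s c' is left invertible too.\<close>
  have "linv s" using linv_var_scalar[OF var(1) c(1) s] .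
  have \<gamma>\<beta>: "madd \<gamma> \<beta> \<in> mexps n" using var assms(2) by (auto intro: madd_mexps)
  obtain c' q where c': "linv c'" "q \<in> F (int (mdeg n (madd \<gamma> \<beta>)))"
    "x i \<otimes> M (madd \<gamma> \<beta>) = c' \<otimes> M (madd (madd \<gamma> \<beta>) (unit_exp i)) \<oplus> q"
    using var_times_M[OF var(1) \<gamma>\<beta>] by auto
  have c'R: "c' \<in> R" using c' by simp
  have sum: "madd (madd \<gamma> \<beta>) (unit_exp i) = madd (madd \<gamma> (unit_exp i)) \<beta>"
    by (metis madd_assoc madd_commute)
  have "M (madd \<gamma> (unit_exp i)) \<otimes> M \<beta> = x i \<otimes> (M \<gamma> \<otimes> M \<beta>)"
    using var v by (simp add: m_assoc)
  also have "\<dots> = (x i \<otimes> c) \<otimes> M (madd \<gamma> \<beta>) \<oplus> x i \<otimes> p"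
    unfolding c(3) using cR v c(2) by (simp add: r_distr m_assoc)
  also have "\<dots> = s \<otimes> (x i \<otimes> M (madd \<gamma> \<beta>)) \<oplus> e \<otimes> M (madd \<gamma> \<beta>) \<oplus> x i \<otimes> p"
    unfolding s(3) using s v c(2) by (simp add: l_distr m_assoc)
  also have "\<dots> = (s \<otimes> c') \<otimes> M (madd (madd \<gamma> (unit_exp i)) \<beta>) \<oplus> (s \<otimes> q \<oplus> e \<otimes> M (madd \<gamma> \<beta>) \<oplus> x i \<otimes> p)"
    unfolding c'(3) sum using s v c c'(2) c'R by (simp add: r_distr m_assoc a_assoc)
  finally have eq: "M (madd \<gamma> (unit_exp i)) \<otimes> M \<beta> = \<dots>" .
  have "s \<otimes> q \<oplus> e \<otimes> M (madd \<gamma> \<beta>) \<oplus> x i \<otimes> p \<in> F (int (mdeg n (madd (madd \<gamma> (unit_exp i)) \<beta>)) - 1)"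
    using s c' \<gamma>\<beta> var(1) var_times_filt[OF var(1) c(2)]
    by (auto intro!: filt_add filt_smult filt_M)
  then show ?case using eq linv_mult[OF \<open>linv s\<close> c'(1)] by blast
qed

text \<open>Each variable in turn is moved past the current coefficient, and each move turns a
  nonzero coefficient into a nonzero one. No product of coefficients arises, so zero divisors do no
  harm here.\<close>

lemma M_scalar:
  assumes "\<alpha> \<in> mexps n" "r \<in> R"
  shows "\<exists>s\<in>R. \<exists>p\<in>F (int (mdeg n \<alpha>) - 1). M \<alpha> \<otimes> r = s \<otimes> M \<alpha> \<oplus> p \<and> (r \<noteq> \<zero> \<longrightarrow> s \<noteq> \<zero>)"
  using assms(1)
proof (induction rule: M_induct)
  case zero
  show ?case using assms(2) by (intro bexI[of _ r] bexI[of _ \<zero>]) simp_all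
next
  case (var i \<beta>)
  then obtain s p where s: "s \<in> R" "p \<in> F (int (mdeg n \<beta>) - 1)" "M \<beta> \<otimes> r = s \<otimes> M \<beta> \<oplus> p"
    "r \<noteq> \<zero> \<longrightarrow> s \<noteq> \<zero>" by auto
  note v = vars[OF var(1)]
  obtain t e where t: "t \<in> R" "e \<in> R" "x i \<otimes> s = t \<otimes> x i \<oplus> e" "s \<noteq> \<zero> \<longrightarrow> t \<noteq> \<zero>"
    using var_scalar_ex[OF var(1) s(1)] by auto
  have "M (madd \<beta> (unit_exp i)) \<otimes> r = x i \<otimes> (M \<beta> \<otimes> r)"
    using var v assms(2) by (simp add: m_assoc)
  also have "\<dots> = (x i \<otimes> s) \<otimes> M \<beta> \<oplus> x i \<otimes> p"
    unfolding s(3) using v s by (simp add: r_distr m_assoc)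
  also have "\<dots> = t \<otimes> M (madd \<beta> (unit_exp i)) \<oplus> (e \<otimes> M \<beta> \<oplus> x i \<otimes> p)"
    unfolding t(3) using var.hyps(3) v s(1,2) t(1,2) by (simp add: l_distr m_assoc a_assoc)
  finally have eq: "M (madd \<beta> (unit_exp i)) \<otimes> r = \<dots>" .
  have "e \<otimes> M \<beta> \<oplus> x i \<otimes> p \<in> F (int (mdeg n (madd \<beta> (unit_exp i))) - 1)"
    using t var var_times_filt[OF var(1) s(2)] by (auto intro!: filt_add filt_smult filt_M)
  then show ?case using eq s t by blast
qed

text \<open>The shift by one turns the strict bound into a filtration index. For d = 0 the index is
  -1 and both sides are the zero group.\<close>

lemma lower_deg_eq: "lower_deg A R n x d = F (int d - 1)"
proof -
  have "f \<in> lower_deg A R n x d \<longleftrightarrow> f \<in> F (int d - 1)" for f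
    using pbw_deg_le_iff[of f "int d - 1"] by (cases "f = \<zero>") (auto simp: lower_deg_def filt_iff)
  then show ?thesis by blast
qed

text \<open>Remainders of degree below |alpha| have coefficient zero at alpha, so that coefficient
  is the leading one. This gives the uniqueness behind the descriptions of sigma and c.\<close>

lemma lead_unique:
  assumes "\<alpha> \<in> mexps n" "s \<in> R" "t \<in> R" "p \<in> F (int (mdeg n \<alpha>) - 1)" "q \<in> F (int (mdeg n \<alpha>) - 1)"
    and "s \<otimes> M \<alpha> \<oplus> p = t \<otimes> M \<alpha> \<oplus> q"
  shows "s = t"
proof -
  have "coef p \<alpha> = \<zero>" "coef q \<alpha> = \<zero>" using assms(4,5) by (auto simp: filt_iff)
  moreover have "coef (s \<otimes> M \<alpha> \<oplus> p) \<alpha> = coef (t \<otimes> M \<alpha> \<oplus> q) \<alpha>" using assms(6) by simp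
  ultimately show ?thesis using assms(1-5) by (simp add: coef_add coef_term)
qed

lemma pbw_sigma_eqI:
  assumes "\<alpha> \<in> mexps n" "s \<in> R" "s \<noteq> \<zero>" "p \<in> F (int (mdeg n \<alpha>) - 1)" "M \<alpha> \<otimes> r = s \<otimes> M \<alpha> \<oplus> p"
  shows "pbw_sigma A R n x \<alpha> r = s"
  unfolding pbw_sigma_def lower_deg_eq
proof (rule the_equality)
  fix t assume "t \<in> R - {\<zero>} \<and> (\<exists>p\<in>F (int (mdeg n \<alpha>) - 1). M \<alpha> \<otimes> r = t \<otimes> M \<alpha> \<oplus> p)"
  then obtain q where q: "t \<in> R" "q \<in> F (int (mdeg n \<alpha>) - 1)" "M \<alpha> \<otimes> r = t \<otimes> M \<alpha> \<oplus> q"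
    by blast
  from lead_unique[OF assms(1) q(1) assms(2) q(2) assms(4)] show "t = s" using q(3) assms(5) by simp
qed (use assms in auto)

lemma pbw_c_eqI:
  assumes "\<alpha> \<in> mexps n" "\<beta> \<in> mexps n" "linv c" "p \<in> F (int (mdeg n (madd \<alpha> \<beta>)) - 1)"
    "M \<alpha> \<otimes> M \<beta> = c \<otimes> M (madd \<alpha> \<beta>) \<oplus> p"
  shows "pbw_c A R n x \<alpha> \<beta> = c"
proof -
  have cR: "c \<in> R" using assms(3) by simp
  show ?thesis
    unfolding pbw_c_def lower_deg_eq
  proof (rule the_equality)
    show "c \<in> R \<and> (\<exists>d\<in>R. d \<otimes> c = \<one>) \<and>
      (\<exists>p\<in>F (int (mdeg n (madd \<alpha> \<beta>)) - 1). M \<alpha> \<otimes> M \<beta> = c \<otimes> M (madd \<alpha> \<beta>) \<oplus> p)"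
      using assms(3-5) unfolding linv_def by blast
  next
    fix d assume "d \<in> R \<and> (\<exists>e\<in>R. e \<otimes> d = \<one>) \<and>
      (\<exists>p\<in>F (int (mdeg n (madd \<alpha> \<beta>)) - 1). M \<alpha> \<otimes> M \<beta> = d \<otimes> M (madd \<alpha> \<beta>) \<oplus> p)"
    then obtain q where q: "d \<in> R" "q \<in> F (int (mdeg n (madd \<alpha> \<beta>)) - 1)"
      "M \<alpha> \<otimes> M \<beta> = d \<otimes> M (madd \<alpha> \<beta>) \<oplus> q" by blast
    from lead_unique[OF madd_mexps[OF assms(1,2)] q(1) cR q(2) assms(4)]
    show "d = c" using q(3) assms(5) by simp
  qed
qed

text \<open>Triple products are what the compatibility axiom of a monomial order speaks
  about.\<close>

lemma M_mult3:
  assumes "\<alpha> \<in> mexps n" "\<beta> \<in> mexps n" "\<gamma> \<in> mexps n"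
  shows "\<exists>c p. linv c \<and> p \<in> F (int (mdeg n (madd (madd \<alpha> \<beta>) \<gamma>)) - 1) \<and>
    M \<alpha> \<otimes> M \<beta> \<otimes> M \<gamma> = c \<otimes> M (madd (madd \<alpha> \<beta>) \<gamma>) \<oplus> p"
proof -
  obtain c p where c: "linv c" "p \<in> F (int (mdeg n (madd \<alpha> \<beta>)) - 1)"
    "M \<alpha> \<otimes> M \<beta> = c \<otimes> M (madd \<alpha> \<beta>) \<oplus> p"
    using M_mult[OF assms(1,2)] by blast
  obtain d q where d: "linv d" "q \<in> F (int (mdeg n (madd (madd \<alpha> \<beta>) \<gamma>)) - 1)"
    "M (madd \<alpha> \<beta>) \<otimes> M \<gamma> = d \<otimes> M (madd (madd \<alpha> \<beta>) \<gamma>) \<oplus> q"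
    using M_mult[OF madd_mexps[OF assms(1,2)] assms(3)] by blast
  have R: "c \<in> R" "d \<in> R" using c d by simp_all
  have "M \<alpha> \<otimes> M \<beta> \<otimes> M \<gamma> = c \<otimes> (M (madd \<alpha> \<beta>) \<otimes> M \<gamma>) \<oplus> p \<otimes> M \<gamma>"
    unfolding c(3) using R c(2) by (simp add: l_distr m_assoc)
  also have "\<dots> = (c \<otimes> d) \<otimes> M (madd (madd \<alpha> \<beta>) \<gamma>) \<oplus> (c \<otimes> q \<oplus> p \<otimes> M \<gamma>)"
    unfolding d(3) using R c(2) d(2) by (simp add: r_distr m_assoc a_assoc)
  finally have "M \<alpha> \<otimes> M \<beta> \<otimes> M \<gamma> = \<dots>" .
  moreover have "p \<otimes> M \<gamma> \<in> F (int (mdeg n (madd \<alpha> \<beta>)) - 1 + int (mdeg n \<gamma>))"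
    by (rule filt_mult[OF c(2) filt_M[OF assms(3) order_refl]])
  then have "c \<otimes> q \<oplus> p \<otimes> M \<gamma> \<in> F (int (mdeg n (madd (madd \<alpha> \<beta>) \<gamma>)) - 1)"
    by (intro filt_add filt_smult[OF R(1) d(2)]) (simp add: algebra_simps)
  ultimately show ?thesis using linv_mult[OF c(1) d(1)] by blast
qed

end

section \<open>Leading terms\<close>

text \<open>If 1 = 0, all monomials are equal and a monomial does not determine its exponent, so
  \<open>mexp\<close> has no meaning.\<close>

locale nontrivial_skew_PBW = skew_PBW +
  assumes one_neq_zero: "\<one> \<noteq> \<zero>"
begin

lemma linv_nonzero: "linv c \<Longrightarrow> c \<noteq> \<zero>"
  using one_neq_zero unfolding linv_def by auto

lemma M_inject: "\<alpha> \<in> mexps n \<Longrightarrow> \<beta> \<in> mexps n \<Longrightarrow> M \<alpha> = M \<beta> \<longleftrightarrow> \<alpha> = \<beta>"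
  using coef_M one_neq_zero by metis

lemma mexp_M: "\<alpha> \<in> mexps n \<Longrightarrow> mexp A n x (M \<alpha>) = \<alpha>"
  unfolding mexp_def by (rule the_equality) (auto simp: M_inject)

text \<open>Replaces the descriptions in \<open>lm\<close>, \<open>mexp\<close> and
  \<open>lc\<close> by a maximality condition on exponents. Antisymmetry of the order and
  injectivity of the monomials make them unique.\<close>

lemma lead_eqI:
  assumes S: "linear_order_on (Mon A n x) S" and f: "f \<in> carrier A"
    and \<alpha>: "coef f \<alpha> \<noteq> \<zero>" "\<And>\<beta>. coef f \<beta> \<noteq> \<zero> \<Longrightarrow> (M \<alpha>, M \<beta>) \<in> S"
  shows "lm A R n x S f = M \<alpha>" "mexp A n x (lm A R n x S f) = \<alpha>" "lc A R n x S f = coef f \<alpha>"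
proof -
  have mex: "\<alpha> \<in> mexps n" using coef_mexps[OF f \<alpha>(1)] .
  have anti: "antisym S" using S by (simp add: order_on_defs)
  show lm: "lm A R n x S f = M \<alpha>"
    unfolding lm_def supp_of_def
    by (rule the_equality) (use \<alpha> antisymD[OF anti] in \<open>blast+\<close>)
  show "mexp A n x (lm A R n x S f) = \<alpha>" by (simp add: lm mexp_M mex)
  then show "lc A R n x S f = coef f \<alpha>" by (simp add: lc_def)
qed

lemma max_exponent_ex:
  assumes S: "linear_order_on (Mon A n x) S" and "finite B" "B \<noteq> {}" "B \<subseteq> mexps n"
  shows "\<exists>\<alpha>\<in>B. \<forall>\<beta>\<in>B. (M \<alpha>, M \<beta>) \<in> S"
  using assms(2-4)
proof (induction rule: finite_ne_induct)
  case (singleton \<alpha>)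
  then show ?case using S by (auto simp: order_on_defs refl_on_def Mon_def)
next
  case (insert \<alpha> B)
  then obtain \<mu> where \<mu>: "\<mu> \<in> B" "\<forall>\<beta>\<in>B. (M \<mu>, M \<beta>) \<in> S" by auto
  have mon: "M \<alpha> \<in> Mon A n x" "M \<mu> \<in> Mon A n x" using insert.prems \<mu> by (auto simp: Mon_def)
  have refl: "(M \<alpha>, M \<alpha>) \<in> S" using S mon by (auto simp: order_on_defs refl_on_def)
  have trans: "trans S" using S by (simp add: order_on_defs)
  show ?case
  proof (cases "(M \<mu>, M \<alpha>) \<in> S")
    case True
    then show ?thesis using \<mu> by blast
  next
    case False
    then have "(M \<alpha>, M \<mu>) \<in> S"
      using S mon refl False unfolding order_on_defs total_on_def by metis
    then have "\<forall>\<beta>\<in>B. (M \<alpha>, M \<beta>) \<in> S" using \<mu> transD[OF trans] by blast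
    then show ?thesis using refl by blast
  qed
qed

lemma lead_ex:
  assumes "linear_order_on (Mon A n x) S" "f \<in> carrier A" "f \<noteq> \<zero>"
  obtains \<alpha> where "coef f \<alpha> \<noteq> \<zero>" "\<And>\<beta>. coef f \<beta> \<noteq> \<zero> \<Longrightarrow> (M \<alpha>, M \<beta>) \<in> S"
  using max_exponent_ex[OF assms(1) supp_of_nonempty[OF assms(2,3)]] by (auto simp: supp_of_def)

text \<open>The leading coefficient is left invertible, hence nonzero, and everything else has
  smaller degree. Only linearity and compatibility with the degree are assumed, because this is also
  applied to the order on Gr(A) before that is known to be a monomial order.\<close>

lemma lm_M_mult3:
  assumes S: "linear_order_on (Mon A n x) S"
    and deg: "\<And>\<alpha> \<beta>. \<alpha> \<in> mexps n \<Longrightarrow> \<beta> \<in> mexps n \<Longrightarrow> mdeg n \<beta> > mdeg n \<alpha> \<Longrightarrow> (M \<beta>, M \<alpha>) \<in> S"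
    and mex: "\<alpha> \<in> mexps n" "\<beta> \<in> mexps n" "\<gamma> \<in> mexps n"
  shows "lm A R n x S (M \<alpha> \<otimes> M \<beta> \<otimes> M \<gamma>) = M (madd (madd \<alpha> \<beta>) \<gamma>)"
proof -
  define \<delta> where "\<delta> = madd (madd \<alpha> \<beta>) \<gamma>"
  have \<delta>: "\<delta> \<in> mexps n" unfolding \<delta>_def using mex by (intro madd_mexps)
  obtain c p where c: "linv c" "p \<in> F (int (mdeg n \<delta>) - 1)" "M \<alpha> \<otimes> M \<beta> \<otimes> M \<gamma> = c \<otimes> M \<delta> \<oplus> p"
    using M_mult3[OF mex] unfolding \<delta>_def by blast
  have R: "c \<in> R" using c by simp
  have p: "coef p \<epsilon> \<noteq> \<zero> \<Longrightarrow> mdeg n \<epsilon> < mdeg n \<delta>" for \<epsilon> using c(2) by (auto simp: filt_iff)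
  have co: "coef (c \<otimes> M \<delta> \<oplus> p) \<epsilon> = (if \<epsilon> = \<delta> then c else coef p \<epsilon>)" for \<epsilon>
    using p[of \<delta>] R c(2) \<delta> by (auto simp: coef_add coef_term)
  have "lm A R n x S (c \<otimes> M \<delta> \<oplus> p) = M \<delta>"
  proof (rule lead_eqI(1)[OF S])
    show "coef (c \<otimes> M \<delta> \<oplus> p) \<delta> \<noteq> \<zero>" using linv_nonzero[OF c(1)] by (simp add: co)
    fix \<epsilon> assume "coef (c \<otimes> M \<delta> \<oplus> p) \<epsilon> \<noteq> \<zero>"
    then show "(M \<delta>, M \<epsilon>) \<in> S"
      using \<delta> S deg p coef_mexps[of p \<epsilon>] c(2)
      by (auto simp: co order_on_defs refl_on_def Mon_def split: if_splits)
  qed (use R c(2) in simp)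
  then show ?thesis unfolding c(3) \<delta>_def[symmetric] .
qed

lemma nonzero_vars:
  assumes "i < n"
  shows "x i \<noteq> \<zero>" "pbw_deg A R n x (x i) = 1"
proof -
  have co: "coef (x i) \<beta> = (if \<beta> = unit_exp i then \<one> else \<zero>)" for \<beta>
    using coef_M[OF unit_exp_mexps[OF assms]] assms by (simp add: M_unit_exp)
  then show "x i \<noteq> \<zero>" using one_neq_zero by (metis coef_zero)
  have "supp_of A R n x (x i) = {unit_exp i}"
    using one_neq_zero by (auto simp: supp_of_def co)
  then show "pbw_deg A R n x (x i) = 1" using assms by (simp add: pbw_deg_def)
qed

end

section \<open>The associated graded ring\<close>

text \<open>\<open>ring_hom\<close> does not presuppose that its target is a ring, so the axioms can
  be pulled back along a surjection. The condition on zero is explicit, since it cannot be derived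
  while the target has no known structure.\<close>

lemma ring_hom_image_ring:
  assumes B: "ring B" and h: "h \<in> ring_hom B G"
    and G: "carrier G = h ` carrier B" "\<zero>\<^bsub>G\<^esub> = h \<zero>\<^bsub>B\<^esub>"
  shows "ring G"
proof -
  interpret B: ring B by (rule B)
  note hom = ring_hom_add[OF h, symmetric] ring_hom_mult[OF h, symmetric] ring_hom_one[OF h, symmetric]
  show ?thesis
  proof (intro ringI abelian_groupI monoidI)
    fix u assume "u \<in> carrier G"
    then obtain a where a: "a \<in> carrier B" "u = h a" using G by auto
    then have "h (\<ominus>\<^bsub>B\<^esub> a) \<oplus>\<^bsub>G\<^esub> u = \<zero>\<^bsub>G\<^esub>" by (simp add: hom G B.l_neg)
    then show "\<exists>v\<in>carrier G. v \<oplus>\<^bsub>G\<^esub> u = \<zero>\<^bsub>G\<^esub>" using a G by auto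
  qed (auto simp: hom G B.a_ac B.m_assoc B.l_distr B.r_distr)
qed

section \<open>Quotients of additive subgroups\<close>

context ring
begin

text \<open>The subgroup L is left general to serve both Gr(A), with L the filtration step F p, and
  Gr(I), with L = (I + F (p - 1)) \<inter> F p. Cosets taken in the restricted structure agree with
  cosets in the ambient ring.\<close>

lemma A_Mod_restrict:
  assumes H: "additive_subgroup H R" and L: "additive_subgroup L R" and HL: "H \<subseteq> L"
  defines "Q \<equiv> (R\<lparr>carrier := L\<rparr>) A_Mod H"
  shows "comm_group Q" "carrier Q = (\<lambda>f. H +> f) ` L" "\<one>\<^bsub>Q\<^esub> = H"
    "\<And>f g. f \<in> L \<Longrightarrow> g \<in> L \<Longrightarrow> (H +> f) \<otimes>\<^bsub>Q\<^esub> (H +> g) = H +> (f \<oplus> g)"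
proof -
  interpret L: additive_subgroup L R by (rule L)
  let ?L = "R\<lparr>carrier := L\<rparr>"
  have grp: "add_monoid ?L = (add_monoid R)\<lparr>carrier := L\<rparr>" by simp
  have ab: "abelian_group ?L"
  proof (rule abelian_groupI)
    fix a assume "a \<in> carrier ?L"
    then show "\<exists>b\<in>carrier ?L. b \<oplus>\<^bsub>?L\<^esub> a = \<zero>\<^bsub>?L\<^esub>"
      using L.a_subset by (intro bexI[of _ "\<ominus> a"]) (auto simp: l_neg)
  qed (use L.a_subset in \<open>auto simp: a_ac subset_eq\<close>)
  have "subgroup H (add_monoid ?L)"
    unfolding grp
    using H L HL by (intro group.subgroup_incl[OF a_group]) (auto simp: additive_subgroup_def)
  then have "abelian_subgroup H ?L"
    using ab by (intro abelian_subgroupI3 additive_subgroupI)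
  then interpret Q: abelian_subgroup H ?L .
  have coset: "a_r_coset ?L H f = H +> f" for f
    by (simp add: a_r_coset_defs)
  show "comm_group Q" unfolding Q_def by (rule Q.a_factorgroup_is_comm_group)
  show "carrier Q = (\<lambda>f. H +> f) ` L"
    unfolding Q_def A_FactGroup_def FactGroup_def
    by (auto simp: RCOSETS_def a_r_coset_defs)
  show "\<one>\<^bsub>Q\<^esub> = H" unfolding Q_def A_FactGroup_def FactGroup_def by simp
  show "(H +> f) \<otimes>\<^bsub>Q\<^esub> (H +> g) = H +> (f \<oplus> g)" if "f \<in> L" "g \<in> L" for f g
    using Q.a_rcos_sum[of f g] that
    unfolding Q_def A_FactGroup_def FactGroup_def coset by (simp add: set_add_def)
qed

lemma A_Mod_restrict_finprod:
  assumes H: "additive_subgroup H R" and L: "additive_subgroup L R" and HL: "H \<subseteq> L"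
    and "finite B" "h \<in> B \<rightarrow> L"
  shows "finprod ((R\<lparr>carrier := L\<rparr>) A_Mod H) (\<lambda>i. H +> h i) B = H +> finsum R h B"
proof -
  note Q = A_Mod_restrict[OF H L HL]
  interpret Q: comm_group "(R\<lparr>carrier := L\<rparr>) A_Mod H" by (rule Q(1))
  interpret L: additive_subgroup L R by (rule L)
  interpret H: additive_subgroup H R by (rule H)
  \<comment> \<open>Membership of the sum in L is carried along, because the addition rule for
    cosets requires it at the next step.\<close>
  have "finprod ((R\<lparr>carrier := L\<rparr>) A_Mod H) (\<lambda>i. H +> h i) B = H +> finsum R h B \<and> finsum R h B \<in> L"
    using assms(4,5)
  proof (induction rule: finite_induct)
    case empty
    then show ?case using Q(3) H.a_subset by simp
  next
    case (insert b B)
    have "h b \<in> L" "h \<in> B \<rightarrow> L" using insert.prems by auto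
    moreover have "h b \<in> carrier R" "h \<in> B \<rightarrow> carrier R" using calculation L.a_subset by auto
    moreover have "(\<lambda>i. H +> h i) \<in> B \<rightarrow> carrier ((R\<lparr>carrier := L\<rparr>) A_Mod H)"
      "H +> h b \<in> carrier ((R\<lparr>carrier := L\<rparr>) A_Mod H)"
      using calculation unfolding Q(2) by auto
    ultimately show ?case using insert.IH insert.hyps by (simp add: Q(4) del: add_A_FactGroup)
  qed
  then show ?thesis ..
qed

end

section \<open>Families of representatives and the ring structure of Gr(A)\<close>

context skew_PBW
begin

definition rees :: "(nat \<Rightarrow> 'a) set" where
  "rees = {a. (\<forall>p. a p \<in> F (int p)) \<and> finite {p. a p \<noteq> \<zero>}}"

definition cls :: "(nat \<Rightarrow> 'a) \<Rightarrow> nat \<Rightarrow> 'a set" where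
  "cls a = (\<lambda>p. F (int p - 1) +> a p)"

lemma reesD: "a \<in> rees \<Longrightarrow> a p \<in> F (int p)" "a \<in> rees \<Longrightarrow> finite {p. a p \<noteq> \<zero>}"
  by (auto simp: rees_def)

lemma rees_carrier [simp]: "a \<in> rees \<Longrightarrow> a p \<in> carrier A"
  using reesD(1) filt_carrier by blast

lemma filt_subset_carrier: "F p \<subseteq> carrier A"
  by auto

lemma filt_subset: "p \<le> q \<Longrightarrow> F p \<subseteq> F q"
  using filt_mono by blast

lemma filt_coset_eq_iff:
  assumes "f \<in> carrier A" "g \<in> carrier A"
  shows "F p +> f = F p +> g \<longleftrightarrow> f \<ominus> g \<in> F p"
proof -
  have sg: "subgroup (F p) (add_monoid A)"
    using filt_additive_subgroup by (simp add: additive_subgroup_def)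
  show ?thesis
  proof
    assume "F p +> f = F p +> g"
    then have "F p +> (f \<oplus> \<ominus> g) = F p"
      using a_coset_add_inv2 assms filt_subset_carrier by blast
    then show "f \<ominus> g \<in> F p"
      unfolding a_minus_def using a_coset_join1[OF _ _ sg] assms by auto
  next
    assume "f \<ominus> g \<in> F p"
    then have "F p +> (f \<oplus> \<ominus> g) = F p"
      unfolding a_minus_def using a_coset_join2[OF _ sg] assms by auto
    then show "F p +> f = F p +> g"
      using a_coset_add_inv1 assms filt_subset_carrier by blast
  qed
qed

lemma filt_coset_zero [simp]: "F p +> \<zero> = F p"
  using filt_subset_carrier by (rule a_coset_add_zero)

lemmas gr_part_facts = A_Mod_restrict[OF filt_additive_subgroup filt_additive_subgroup filt_subset,
    of "int p - 1" "int p" for p, folded gr_part_def, simplified]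

text \<open>Independence of representatives: changing f by a and g by b changes the product by a (b
  + g) + f b, which lies one step lower in the filtration.\<close>

lemma filt_rcoset_mult:
  assumes f: "f \<in> F (int p)" and g: "g \<in> F (int q)"
  shows "rcoset_mult A (F (int (p + q) - 1)) (F (int p - 1) +> f) (F (int q - 1) +> g)
    = F (int (p + q) - 1) +> (f \<otimes> g)"
proof -
  have eq: "F (int (p + q) - 1) +> ((a \<oplus> f) \<otimes> (b \<oplus> g)) = F (int (p + q) - 1) +> (f \<otimes> g)"
    if a: "a \<in> F (int p - 1)" and b: "b \<in> F (int q - 1)" for a b
  proof -
    have c: "a \<in> carrier A" "b \<in> carrier A" "f \<in> carrier A" "g \<in> carrier A"
      using a b f g filt_carrier by blast+
    have "(a \<oplus> f) \<otimes> (b \<oplus> g) \<ominus> f \<otimes> g = a \<otimes> (b \<oplus> g) \<oplus> f \<otimes> b"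
    proof -
      have "(a \<oplus> f) \<otimes> (b \<oplus> g) = (a \<otimes> (b \<oplus> g) \<oplus> f \<otimes> b) \<oplus> f \<otimes> g"
        using c by (simp add: l_distr r_distr a_ac)
      then show ?thesis using c by (simp add: a_minus_def a_assoc r_neg)
    qed
    moreover have "b \<oplus> g \<in> F (int q)" using filt_mono[OF b] g by (intro filt_add) auto
    then have "a \<otimes> (b \<oplus> g) \<in> F (int (p + q) - 1)" "f \<otimes> b \<in> F (int (p + q) - 1)"
      using filt_mult[OF a, of "b \<oplus> g" "int q"] filt_mult[OF f b] by (simp_all add: algebra_simps)
    ultimately show ?thesis
      using c by (subst filt_coset_eq_iff) (auto intro: filt_add)
  qed
  \<comment> \<open>\<open>rcoset_mult\<close> is a union of cosets over all representatives. They
    all coincide, and the zero elements show that the union is not over an empty index set.\<close>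
  show ?thesis
    unfolding rcoset_mult_def a_r_coset_def' using filt_zero[of "int p - 1"] filt_zero[of "int q - 1"]
    using eq[unfolded a_r_coset_def'] by (simp del: filt_zero) blast
qed

text \<open>Finitely supported families of cosets are exactly the classes of finitely supported
  families of representatives, so no choice of cosets has to be revisited afterwards.\<close>

lemma sum_group_cosets:
  assumes add: "\<And>p. additive_subgroup (L p) A" and L: "\<And>p. F (int p - 1) \<subseteq> L p" "\<And>p. L p \<subseteq> F (int p)"
  shows "carrier (sum_group UNIV (\<lambda>p. (A\<lparr>carrier := L p\<rparr>) A_Mod F (int p - 1)))
    = cls ` {a \<in> rees. \<forall>p. a p \<in> L p}"
proof -
  note Q = A_Mod_restrict[OF filt_additive_subgroup add L(1)]
  have grp: "group ((A\<lparr>carrier := L p\<rparr>) A_Mod F (int p - 1))" for p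
    using Q(1) comm_group.axioms(2) by blast
  have sub: "u \<in> cls ` {a \<in> rees. \<forall>p. a p \<in> L p}"
    if u: "\<And>p. u p \<in> (\<lambda>f. F (int p - 1) +> f) ` L p" "finite {p. u p \<noteq> F (int p - 1)}" for u
  proof -
    \<comment> \<open>Zero is chosen wherever the coset is trivial; otherwise the family of
      representatives could have infinite support.\<close>
    have "\<exists>f\<in>L p. u p = F (int p - 1) +> f \<and> (u p = F (int p - 1) \<longrightarrow> f = \<zero>)" for p
    proof (cases "u p = F (int p - 1)")
      case True
      have "\<zero> \<in> L p" using L(1) filt_zero by blast
      then show ?thesis using True by (intro bexI[of _ \<zero>]) simp_all
    qed (use u(1)[of p] in auto)
    then obtain a where a: "\<And>p. a p \<in> L p" "\<And>p. u p = F (int p - 1) +> a p"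
      "\<And>p. u p = F (int p - 1) \<Longrightarrow> a p = \<zero>" by metis
    have "{p. a p \<noteq> \<zero>} \<subseteq> {p. u p \<noteq> F (int p - 1)}" using a(3) by blast
    then have "a \<in> rees" unfolding rees_def using a(1) L(2) u(2) finite_subset by blast
    moreover have "u = cls a" unfolding cls_def using a(2) by (rule ext)
    ultimately show ?thesis using a(1) by blast
  qed
  have fin: "finite {p. cls a p \<noteq> F (int p - 1)}" if "a \<in> rees" for a
    using reesD(2)[OF that] by (rule rev_finite_subset) (auto simp: cls_def)
  show ?thesis
    unfolding carrier_sum_group[OF grp] Q(2,3)
  proof (intro subset_antisym subsetI)
    fix u assume "u \<in> {u \<in> \<Pi>\<^sub>E p\<in>UNIV. (\<lambda>f. F (int p - 1) +> f) ` L p.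
      finite {p \<in> UNIV. u p \<noteq> F (int p - 1)}}"
    then show "u \<in> cls ` {a \<in> rees. \<forall>p. a p \<in> L p}" by (intro sub) auto
  qed (use fin in \<open>auto simp: cls_def\<close>)
qed

lemma carrier_Gr: "carrier (Gr A R n x) = cls ` rees"
proof -
  have "carrier (Gr A R n x) = cls ` {a \<in> rees. \<forall>p. a p \<in> F (int p)}"
    unfolding Gr_def partial_object.simps
    using sum_group_cosets[of "\<lambda>p. F (int p)"] filt_additive_subgroup filt_subset
    by (simp add: gr_part_def[abs_def])
  then show ?thesis using reesD(1) by (simp add: Collect_mono_iff cong: conj_cong)
qed

lemma zero_Gr: "\<zero>\<^bsub>Gr A R n x\<^esub> = (\<lambda>p. F (int p - 1))"
  by (simp add: Gr_def gr_part_facts(3) restrict_def)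

lemma cls_zero: "cls (\<lambda>_. \<zero>) = \<zero>\<^bsub>Gr A R n x\<^esub>"
  by (simp add: cls_def zero_Gr)

lemma one_Gr: "\<one>\<^bsub>Gr A R n x\<^esub> = cls (\<lambda>p. if p = 0 then \<one> else \<zero>)"
  by (simp add: Gr_def cls_def fun_eq_iff)

lemma add_Gr:
  assumes "a \<in> rees" "b \<in> rees"
  shows "cls a \<oplus>\<^bsub>Gr A R n x\<^esub> cls b = cls (\<lambda>p. a p \<oplus> b p)"
  using gr_part_facts(4)[OF reesD(1)[OF assms(1)] reesD(1)[OF assms(2)]]
  by (simp add: Gr_def cls_def restrict_def)

text \<open>On representatives the graded product is convolution, that is, multiplication of
  polynomials. This makes \<open>cls\<close> multiplicative.\<close>

lemma mult_Gr:
  assumes "a \<in> rees" "b \<in> rees"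
  shows "cls a \<otimes>\<^bsub>Gr A R n x\<^esub> cls b = cls (\<lambda>p. \<Oplus>i\<in>{..p}. a i \<otimes> b (p - i))"
proof
  fix p
  have prod: "rcoset_mult A (F (int p - 1)) (cls a i) (cls b (p - i)) = F (int p - 1) +> (a i \<otimes> b (p - i))"
    if "i \<le> p" for i
    using filt_rcoset_mult[OF reesD(1)[OF assms(1)] reesD(1)[OF assms(2)], of i "p - i"] that
    by (simp add: cls_def)
  have mem: "a i \<otimes> b (p - i) \<in> F (int p)" if "i \<le> p" for i
    using filt_mult[OF reesD(1)[OF assms(1)] reesD(1)[OF assms(2)], of i "p - i"] that by simp
  interpret Q: comm_group "gr_part A R n x p" by (rule gr_part_facts(1))
  have "finprod (gr_part A R n x p) (\<lambda>i. rcoset_mult A (F (int p - 1)) (cls a i) (cls b (p - i))) {..p}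
    = finprod (gr_part A R n x p) (\<lambda>i. F (int p - 1) +> (a i \<otimes> b (p - i))) {..p}"
    using prod mem gr_part_facts(2) by (intro Q.finprod_cong') auto
  also have "\<dots> = F (int p - 1) +> (\<Oplus>i\<in>{..p}. a i \<otimes> b (p - i))"
    unfolding gr_part_def
    by (rule A_Mod_restrict_finprod[OF filt_additive_subgroup filt_additive_subgroup filt_subset])
      (use mem in auto)
  finally show "(cls a \<otimes>\<^bsub>Gr A R n x\<^esub> cls b) p = cls (\<lambda>p. \<Oplus>i\<in>{..p}. a i \<otimes> b (p - i)) p"
    by (simp add: Gr_def cls_def)
qed

lemma rees_up: "a \<in> rees \<Longrightarrow> a \<in> up A"
proof
  assume a: "a \<in> rees"
  obtain N where "\<forall>p\<in>{p. a p \<noteq> \<zero>}. p \<le> N"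
    using reesD(2)[OF a] finite_nat_set_iff_bounded_le by auto
  then have "bound \<zero> N a" by (auto intro!: bound.intro simp: not_le[symmetric])
  then show "\<exists>N. bound \<zero> N a" ..
qed simp

lemma up_rees: "a \<in> up A \<Longrightarrow> (\<And>p. a p \<in> F (int p)) \<Longrightarrow> a \<in> rees"
proof -
  assume a: "a \<in> up A" "\<And>p. a p \<in> F (int p)"
  then obtain N where "bound \<zero> N a" by blast
  then have "{p. a p \<noteq> \<zero>} \<subseteq> {..N}" using bound.bound[of _ N a] by (auto simp: not_less[symmetric])
  then show "a \<in> rees" unfolding rees_def using a(2) finite_subset by blast
qed

lemma rees_zero: "(\<lambda>_. \<zero>) \<in> rees"
  by (simp add: rees_def)

lemma rees_one: "(\<lambda>p. if p = 0 then \<one> else \<zero>) \<in> rees"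
  by (rule up_rees[OF up_one_closed]) simp

lemma rees_add: "a \<in> rees \<Longrightarrow> b \<in> rees \<Longrightarrow> (\<lambda>p. a p \<oplus> b p) \<in> rees"
  by (rule up_rees[OF up_add_closed]) (auto intro: rees_up filt_add reesD)

lemma rees_neg: "a \<in> rees \<Longrightarrow> (\<lambda>p. \<ominus> a p) \<in> rees"
  by (rule up_rees[OF up_a_inv_closed]) (auto intro: rees_up filt_neg reesD)

lemma rees_mult: "a \<in> rees \<Longrightarrow> b \<in> rees \<Longrightarrow> (\<lambda>p. \<Oplus>i\<in>{..p}. a i \<otimes> b (p - i)) \<in> rees"
proof (rule up_rees[OF up_mult_closed])
  fix p assume ab: "a \<in> rees" "b \<in> rees"
  have "a i \<otimes> b (p - i) \<in> F (int p)" if "i \<le> p" for i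
    using filt_mult[OF reesD(1)[OF ab(1)] reesD(1)[OF ab(2)], of i "p - i"] that by simp
  then show "(\<Oplus>i\<in>{..p}. a i \<otimes> b (p - i)) \<in> F (int p)" by (intro filt_finsum) auto
qed (auto intro: rees_up)

text \<open>
  The family \<open>a\<close> in \<^term>\<open>rees\<close> is the element \<open>\<Sum>\<^sub>p a\<^sub>p t\<^sup>p\<close> of the Rees ring, a subring of \<open>A[t]\<close>; the
  ring axioms of \<open>Gr(A)\<close> are inherited along the surjection \<^term>\<open>cls\<close>.
\<close>

lemma ring_Gr: "ring (Gr A R n x)"
proof -
  interpret UP: UP_ring A "UP A" by unfold_locales
  have "subring rees (UP A)"
  proof (rule UP.subringI)
    show "rees \<subseteq> carrier (UP A)" by (auto simp: UP_def rees_up)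
    show "\<one>\<^bsub>UP A\<^esub> \<in> rees" by (simp add: UP_def rees_one)
    fix a b assume a: "a \<in> rees" and b: "b \<in> rees"
    then show "a \<otimes>\<^bsub>UP A\<^esub> b \<in> rees" "a \<oplus>\<^bsub>UP A\<^esub> b \<in> rees"
      by (simp_all add: UP_def rees_up rees_mult rees_add)
    have neg: "(\<lambda>p. \<ominus> a p) \<in> rees" using rees_neg[OF a] .
    have "(\<lambda>p. \<ominus> a p) \<oplus>\<^bsub>UP A\<^esub> a = \<zero>\<^bsub>UP A\<^esub>"
      using a neg by (auto simp: UP_def rees_up l_neg)
    moreover have "a \<in> carrier (UP A)" "(\<lambda>p. \<ominus> a p) \<in> carrier (UP A)"
      using a neg by (simp_all add: UP_def rees_up)
    ultimately have "\<ominus>\<^bsub>UP A\<^esub> a = (\<lambda>p. \<ominus> a p)" using UP.minus_equality by blast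
    then show "\<ominus>\<^bsub>UP A\<^esub> a \<in> rees" using neg by simp
  qed
  then have "ring ((UP A)\<lparr>carrier := rees\<rparr>)" by (rule UP.subring_is_ring)
  then show ?thesis
  proof (rule ring_hom_image_ring)
    show "cls \<in> ring_hom (UP A\<lparr>carrier := rees\<rparr>) (Gr A R n x)"
      by (rule ring_hom_memI) (auto simp: carrier_Gr mult_Gr add_Gr one_Gr UP_def rees_up)
  qed (simp_all add: carrier_Gr cls_zero[symmetric] UP_def)
qed

section \<open>Homogeneous elements and the copy of R\<close>

abbreviation G :: "(nat \<Rightarrow> 'a set) ring" where
  "G \<equiv> Gr A R n x"

abbreviation E :: "nat \<Rightarrow> 'a \<Rightarrow> nat \<Rightarrow> 'a set" where
  "E p f \<equiv> gr_elt A R n x p f"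

lemma gr_elt_cls:
  assumes "f \<in> F (int p)"
  shows "(\<lambda>q. if q = p then f else \<zero>) \<in> rees" "E p f = cls (\<lambda>q. if q = p then f else \<zero>)"
  using assms by (auto simp: rees_def gr_elt_def cls_def fun_eq_iff)

lemma gr_elt_closed [simp]: "f \<in> F (int p) \<Longrightarrow> E p f \<in> carrier G"
  using gr_elt_cls carrier_Gr by auto

lemma cls_eq_iff:
  assumes "a \<in> rees" "b \<in> rees"
  shows "cls a = cls b \<longleftrightarrow> (\<forall>p. a p \<ominus> b p \<in> F (int p - 1))"
  using assms by (simp add: cls_def fun_eq_iff filt_coset_eq_iff)

lemma gr_elt_eq_iff:
  assumes "f \<in> F (int p)" "g \<in> F (int p)"
  shows "E p f = E p g \<longleftrightarrow> f \<ominus> g \<in> F (int p - 1)"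
  unfolding gr_elt_def fun_eq_iff
  using filt_coset_eq_iff[OF filt_carrier[OF assms(1)] filt_carrier[OF assms(2)], of "int p - 1"] by auto

lemma gr_elt_zero: "E p \<zero> = \<zero>\<^bsub>G\<^esub>"
  by (auto simp: gr_elt_def zero_Gr fun_eq_iff)

lemma gr_elt_eq_zero_iff: "f \<in> F (int p) \<Longrightarrow> E p f = \<zero>\<^bsub>G\<^esub> \<longleftrightarrow> f \<in> F (int p - 1)"
  unfolding gr_elt_zero[of p, symmetric] by (simp add: gr_elt_eq_iff minus_eq)

lemma gr_elt_one: "E 0 \<one> = \<one>\<^bsub>G\<^esub>"
  by (simp add: one_Gr gr_elt_cls)

lemma gr_elt_add:
  assumes "f \<in> F (int p)" "g \<in> F (int p)"
  shows "E p f \<oplus>\<^bsub>G\<^esub> E p g = E p (f \<oplus> g)"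
proof -
  have "(\<lambda>q. (if q = p then f else \<zero>) \<oplus> (if q = p then g else \<zero>)) = (\<lambda>q. if q = p then f \<oplus> g else \<zero>)"
    by auto
  then show ?thesis using assms by (simp add: gr_elt_cls filt_add add_Gr)
qed

lemma gr_elt_mult:
  assumes f: "f \<in> F (int p)" and g: "g \<in> F (int q)"
  shows "E p f \<otimes>\<^bsub>G\<^esub> E q g = E (p + q) (f \<otimes> g)"
proof -
  have c: "f \<in> carrier A" "g \<in> carrier A" using f g filt_carrier by blast+
  have "f \<otimes> g \<in> F (int (p + q))" using filt_mult[OF f g] by simp
  moreover have "(\<Oplus>i\<in>{..r}. (if i = p then f else \<zero>) \<otimes> (if r - i = q then g else \<zero>))
    = (if r = p + q then f \<otimes> g else \<zero>)" (is "finsum A ?h {..r} = _") for r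
  proof (cases "r = p + q")
    case True
    have "finsum A ?h {..r} = (\<Oplus>i\<in>{..r}. if p = i then f \<otimes> g else \<zero>)"
      using c True by (intro finsum_cong') auto
    also have "\<dots> = f \<otimes> g"
      using c True finsum_singleton[of p "{..r}" "\<lambda>_. f \<otimes> g"] by simp
    finally show ?thesis using True by simp
  next
    case False
    have "finsum A ?h {..r} = (\<Oplus>i\<in>{..r}. \<zero>)"
      using c False by (intro finsum_cong') auto
    then show ?thesis using False by simp
  qed
  ultimately show ?thesis
    using gr_elt_cls[OF f] gr_elt_cls[OF g] by (simp add: gr_elt_cls mult_Gr)
qed

lemma gr_elt_uminus:
  assumes "f \<in> F (int p)"
  shows "\<ominus>\<^bsub>G\<^esub> E p f = E p (\<ominus> f)"
proof -
  interpret G: ring G by (rule ring_Gr)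
  have "E p (\<ominus> f) \<oplus>\<^bsub>G\<^esub> E p f = \<zero>\<^bsub>G\<^esub>"
    using assms filt_neg[OF assms] by (simp add: gr_elt_add l_neg gr_elt_zero)
  then show ?thesis using G.minus_equality assms filt_neg[OF assms] by simp
qed

abbreviation base_emb :: "'a \<Rightarrow> nat \<Rightarrow> 'a set" where
  "base_emb \<equiv> gr_elt A R n x 0"

lemma base_emb_simps:
  assumes "r \<in> R" "s \<in> R"
  shows "base_emb r \<oplus>\<^bsub>G\<^esub> base_emb s = base_emb (r \<oplus> s)"
    "base_emb r \<otimes>\<^bsub>G\<^esub> base_emb s = base_emb (r \<otimes> s)"
    "\<ominus>\<^bsub>G\<^esub> base_emb r = base_emb (\<ominus> r)"
  using assms gr_elt_mult[of r 0 s 0] by (simp_all add: gr_elt_add gr_elt_uminus)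

text \<open>In degree 0 the quotient is by F (-1) = 0, so R is embedded faithfully.\<close>

lemma base_emb_eq_iff: "r \<in> R \<Longrightarrow> s \<in> R \<Longrightarrow> base_emb r = base_emb s \<longleftrightarrow> r = s"
  using gr_elt_eq_iff[of r 0 s] by (simp add: filt_neg_index)

lemma base_emb_eq_zero_iff: "r \<in> R \<Longrightarrow> base_emb r = \<zero>\<^bsub>G\<^esub> \<longleftrightarrow> r = \<zero>"
  using base_emb_eq_iff[of r \<zero>] by (simp add: gr_elt_zero)

lemma base_emb_mult: "r \<in> R \<Longrightarrow> f \<in> F (int p) \<Longrightarrow> base_emb r \<otimes>\<^bsub>G\<^esub> E p f = E p (r \<otimes> f)"
  using gr_elt_mult[of r 0 f p] by simp

lemma gr_base_subring: "subring (gr_base A R n x) G"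
proof -
  interpret G: ring G by (rule ring_Gr)
  show ?thesis
  proof (rule G.subringI)
    show "\<one>\<^bsub>G\<^esub> \<in> gr_base A R n x" unfolding gr_base_def gr_elt_one[symmetric] by simp
  qed (auto simp: gr_base_def base_emb_simps R_closed)
qed

text \<open>The coefficient at alpha is read from the component of degree |alpha| only: in a
  component of higher degree a term at x^alpha vanishes modulo the preceding filtration
  step.\<close>

definition gr_coef :: "(nat \<Rightarrow> 'a) \<Rightarrow> (nat \<Rightarrow> nat) \<Rightarrow> 'a" where
  "gr_coef a \<alpha> = coef (a (mdeg n \<alpha>)) \<alpha>"

lemma gr_coef_families:
  assumes "a \<in> rees"
  shows "gr_coef a \<in> coeff_families A R n"
proof (rule coeff_familiesI)
  show "finite (\<Union>p\<in>{p. a p \<noteq> \<zero>}. {\<alpha>. coef (a p) \<alpha> \<noteq> \<zero>})"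
    using assms reesD(2) coef_finite by auto
  show "(\<Union>p\<in>{p. a p \<noteq> \<zero>}. {\<alpha>. coef (a p) \<alpha> \<noteq> \<zero>}) \<subseteq> mexps n"
    using assms coef_mexps[OF rees_carrier] by auto
  fix \<alpha>
  show "gr_coef a \<alpha> \<in> R" using assms by (simp add: gr_coef_def)
  assume "gr_coef a \<alpha> \<noteq> \<zero>"
  then show "\<alpha> \<in> (\<Union>p\<in>{p. a p \<noteq> \<zero>}. {\<alpha>. coef (a p) \<alpha> \<noteq> \<zero>})"
    unfolding gr_coef_def by (cases "a (mdeg n \<alpha>) = \<zero>") auto
qed

text \<open>The linear combination of monomials sorted by degree, which is the canonical
  representative of the same combination of the symbols of these monomials.\<close>

definition graded_comb :: "((nat \<Rightarrow> nat) \<Rightarrow> 'a) \<Rightarrow> (nat \<Rightarrow> nat) set \<Rightarrow> nat \<Rightarrow> 'a" where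
  "graded_comb d B p = (\<Oplus>\<alpha>\<in>{\<alpha> \<in> B. mdeg n \<alpha> = p}. d \<alpha> \<otimes> M \<alpha>)"

lemma graded_comb_rees:
  assumes "finite B" "B \<subseteq> mexps n" "\<And>\<alpha>. d \<alpha> \<in> R"
  shows "graded_comb d B \<in> rees"
proof -
  have "graded_comb d B p \<in> F (int p)" for p
    unfolding graded_comb_def using assms by (intro filt_finsum filt_smult filt_M) auto
  moreover have "graded_comb d B p = \<zero>" if "p \<notin> mdeg n ` B" for p
  proof -
    have "{\<alpha> \<in> B. mdeg n \<alpha> = p} = {}" using that by auto
    then show ?thesis unfolding graded_comb_def by (simp only: finsum_empty)
  qed
  then have "{p. graded_comb d B p \<noteq> \<zero>} \<subseteq> mdeg n ` B" by blast
  ultimately show ?thesis unfolding rees_def using assms(1) finite_surj by blast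
qed

lemma coef_graded_comb:
  assumes "finite B" "B \<subseteq> mexps n" "\<And>\<alpha>. d \<alpha> \<in> R"
  shows "coef (graded_comb d B p) \<alpha> = (if \<alpha> \<in> B \<and> mdeg n \<alpha> = p then d \<alpha> else \<zero>)"
proof -
  let ?B = "{\<alpha> \<in> B. mdeg n \<alpha> = p}" and ?c = "\<lambda>\<alpha>. if \<alpha> \<in> B \<and> mdeg n \<alpha> = p then d \<alpha> else \<zero>"
  have "graded_comb d B p = (\<Oplus>\<alpha>\<in>?B. ?c \<alpha> \<otimes> M \<alpha>)"
    unfolding graded_comb_def using assms by (intro finsum_cong') auto
  then have "coef (graded_comb d B p) = ?c"
    using assms by (intro coef_eqI[where B = ?B]) (auto split: if_splits)
  then show ?thesis by simp
qed

text \<open>In each degree p the two representatives share their terms of degree p, so they differ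
  by an element of F (p - 1).\<close>

lemma cls_graded_comb:
  assumes a: "a \<in> rees"
  shows "cls a = cls (graded_comb (gr_coef a) {\<alpha>. gr_coef a \<alpha> \<noteq> \<zero>})" (is "_ = cls ?g")
proof -
  note d = coeff_familiesD[OF gr_coef_families[OF a]]
  have g: "?g \<in> rees" using d by (intro graded_comb_rees) auto
  have B: "{\<alpha>. gr_coef a \<alpha> \<noteq> \<zero>} \<subseteq> mexps n" using d(2) by blast
  have co: "coef (?g p) \<alpha> = (if gr_coef a \<alpha> \<noteq> \<zero> \<and> mdeg n \<alpha> = p then gr_coef a \<alpha> else \<zero>)" for p \<alpha>
    using coef_graded_comb[OF d(3) B d(1)] by simp
  have "a p \<ominus> ?g p \<in> F (int p - 1)" for p
    unfolding filt_iff
  proof (intro conjI allI impI)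
    fix \<alpha> assume nz: "coef (a p \<ominus> ?g p) \<alpha> \<noteq> \<zero>"
    have "a p \<ominus> ?g p \<in> F (int p)" using a g by (intro filt_minus) (auto intro: reesD)
    then have "mdeg n \<alpha> \<le> p" using nz by (auto simp: filt_iff)
    moreover have "mdeg n \<alpha> \<noteq> p"
    proof
      assume *: "mdeg n \<alpha> = p"
      then have "coef (?g p) \<alpha> = gr_coef a \<alpha>" by (simp add: co)
      also have "\<dots> = coef (a p) \<alpha>" by (simp add: gr_coef_def *)
      finally have "coef (?g p) \<alpha> = coef (a p) \<alpha>" .
      then have "coef (a p \<ominus> ?g p) \<alpha> = coef (a p) \<alpha> \<ominus> coef (a p) \<alpha>"
        using a g by (simp add: coef_minus)
      then show False using nz a by (simp add: minus_eq[of "coef (a p) \<alpha>"] r_neg)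
    qed
    ultimately show "int (mdeg n \<alpha>) \<le> int p - 1" by simp
  qed (use a g in simp)
  then show ?thesis using cls_eq_iff[OF a g] by blast
qed

text \<open>Representatives of the same class differ by an element of F (p - 1) in degree p, which
  has no coefficient at exponents of degree p. This is the uniqueness half of freeness of
  Gr(A).\<close>

lemma cls_graded_comb_inject:
  assumes B: "finite B" "B \<subseteq> mexps n" and d: "\<And>\<alpha>. d \<alpha> \<in> R" "\<And>\<alpha>. d' \<alpha> \<in> R"
    and eq: "cls (graded_comb d B) = cls (graded_comb d' B)" and "\<alpha> \<in> B"
  shows "d \<alpha> = d' \<alpha>"
proof -
  let ?p = "mdeg n \<alpha>"
  have g: "graded_comb d B \<in> rees" "graded_comb d' B \<in> rees"
    using graded_comb_rees[OF B] d by auto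
  have "graded_comb d B ?p \<ominus> graded_comb d' B ?p \<in> F (int ?p - 1)"
    using eq cls_eq_iff[OF g] by blast
  then have "coef (graded_comb d B ?p \<ominus> graded_comb d' B ?p) \<alpha> = \<zero>"
    by (auto simp: filt_iff)
  then have "d \<alpha> \<ominus> d' \<alpha> = \<zero>"
    using g \<open>\<alpha> \<in> B\<close> by (simp add: coef_minus coef_graded_comb[OF B] d)
  then show ?thesis using d by simp
qed

end

section \<open>Gr(A) as a skew PBW extension\<close>

context nontrivial_skew_PBW
begin

lemma gr_vars_eq: "i < n \<Longrightarrow> gr_vars A R n x i = E 1 (x i)"
  by (simp add: gr_vars_def symb_def nonzero_vars)

lemma vars_filt: "i < n \<Longrightarrow> x i \<in> F 1"
  using filt_M[of "unit_exp i" 1] by (simp add: M_unit_exp unit_exp_mexps)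

text \<open>The induction runs over an initial segment of m variables while A keeps all n of them,
  since degree, filtration and Gr(A) refer to n. Filtration membership is part of the claim because
  symbols may be multiplied only in matching degrees.\<close>

lemma mon_Gr_aux:
  assumes "m \<le> n"
  shows "mon A m x \<alpha> \<in> F (int (mdeg m \<alpha>)) \<and> mon G m (gr_vars A R n x) \<alpha> = E (mdeg m \<alpha>) (mon A m x \<alpha>)"
  using assms
proof (induction m)
  case 0
  then show ?case by (simp add: mdeg_def gr_elt_one)
next
  case (Suc m)
  interpret G: ring G by (rule ring_Gr)
  have m: "m < n" using Suc.prems by simp
  have pow: "x m [^] k \<in> F (int k) \<and> E 1 (x m) [^]\<^bsub>G\<^esub> k = E k (x m [^] k)" for k :: nat
  proof (induction k)
    case (Suc k)
    then show ?case
      using filt_mult[of "x m [^] k" "int k" "x m" 1] gr_elt_mult[of "x m [^] k" k "x m" 1] vars_filt[OF m]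
      by (simp add: add.commute)
  qed (simp add: gr_elt_one)
  have "mdeg (Suc m) \<alpha> = mdeg m \<alpha> + \<alpha> m" by (simp add: mdeg_def)
  then show ?case
    using Suc.IH m pow[of "\<alpha> m"] filt_mult[of "mon A m x \<alpha>" "int (mdeg m \<alpha>)" "x m [^] \<alpha> m" "int (\<alpha> m)"]
    by (simp add: gr_vars_eq gr_elt_mult)
qed

lemma mon_Gr: "mon G n (gr_vars A R n x) \<alpha> = E (mdeg n \<alpha>) (M \<alpha>)"
  using mon_Gr_aux[of n] by simp

lemma finsum_Gr:
  assumes "finite B" "B \<subseteq> mexps n" "\<And>\<alpha>. d \<alpha> \<in> R"
  shows "(\<Oplus>\<^bsub>G\<^esub>\<alpha>\<in>B. base_emb (d \<alpha>) \<otimes>\<^bsub>G\<^esub> mon G n (gr_vars A R n x) \<alpha>) = cls (graded_comb d B)"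
  using assms(1,2)
proof (induction rule: finite_induct)
  case empty
  interpret G: ring G by (rule ring_Gr)
  show ?case by (simp add: graded_comb_def[abs_def] cls_zero)
next
  case (insert \<alpha> B)
  interpret G: ring G by (rule ring_Gr)
  let ?t = "\<lambda>\<alpha>. base_emb (d \<alpha>) \<otimes>\<^bsub>G\<^esub> mon G n (gr_vars A R n x) \<alpha>"
  have t: "d \<beta> \<otimes> M \<beta> \<in> F (int (mdeg n \<beta>))" "?t \<beta> = E (mdeg n \<beta>) (d \<beta> \<otimes> M \<beta>)" if "\<beta> \<in> mexps n" for \<beta>
    using that assms(3) filt_M[OF that order_refl] by (simp_all add: mon_Gr base_emb_mult filt_smult)
  have mem: "?t \<beta> \<in> carrier G" if "\<beta> \<in> insert \<alpha> B" for \<beta>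
    using t[of \<beta>] that insert.prems by auto
  have \<alpha>: "\<alpha> \<in> mexps n" "B \<subseteq> mexps n" using insert.prems by auto
  have "graded_comb d (insert \<alpha> B) = (\<lambda>p. (if p = mdeg n \<alpha> then d \<alpha> \<otimes> M \<alpha> else \<zero>) \<oplus> graded_comb d B p)"
  proof
    fix p
    have c: "(\<lambda>\<alpha>. d \<alpha> \<otimes> M \<alpha>) \<in> C \<rightarrow> carrier A" for C using assms(3) by simp
    have eq: "{\<beta> \<in> insert \<alpha> B. mdeg n \<beta> = p} =
      (if p = mdeg n \<alpha> then insert \<alpha> {\<beta> \<in> B. mdeg n \<beta> = p} else {\<beta> \<in> B. mdeg n \<beta> = p})" by auto
    show "graded_comb d (insert \<alpha> B) p = (if p = mdeg n \<alpha> then d \<alpha> \<otimes> M \<alpha> else \<zero>) \<oplus> graded_comb d B p"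
      unfolding graded_comb_def eq using insert.hyps c assms(3) by (simp add: finsum_insert)
  qed
  then have "cls (graded_comb d (insert \<alpha> B)) = ?t \<alpha> \<oplus>\<^bsub>G\<^esub> cls (graded_comb d B)"
    using add_Gr[OF gr_elt_cls(1)[OF t(1)[OF \<alpha>(1)]] graded_comb_rees[OF insert.hyps(1) \<alpha>(2) assms(3)]]
      gr_elt_cls(2)[OF t(1)[OF \<alpha>(1)]] t(2)[OF \<alpha>(1)] by simp
  moreover have "finsum G ?t (insert \<alpha> B) = ?t \<alpha> \<oplus>\<^bsub>G\<^esub> finsum G ?t B"
    using mem insert.hyps by (intro G.finsum_insert) auto
  ultimately show ?case using insert.IH[OF \<alpha>(2)] by simp
qed

text \<open>The embedding of R is injective, so supports are preserved. Any finite superset B is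
  allowed so that two families can be compared on a common set.\<close>

lemma left_comb_Gr:
  assumes "d \<in> coeff_families A R n" "finite B" "B \<subseteq> mexps n" "\<And>\<alpha>. d \<alpha> \<noteq> \<zero> \<Longrightarrow> \<alpha> \<in> B"
  shows "left_comb G n (gr_vars A R n x) (\<lambda>\<alpha>. base_emb (d \<alpha>)) = cls (graded_comb d B)"
proof -
  interpret G: ring G by (rule ring_Gr)
  note d = coeff_familiesD[OF assms(1)]
  have supp: "{\<alpha>. base_emb (d \<alpha>) \<noteq> \<zero>\<^bsub>G\<^esub>} = {\<alpha>. d \<alpha> \<noteq> \<zero>}" using d(1) by (simp add: base_emb_eq_zero_iff)
  have mem: "base_emb (d \<beta>) \<in> carrier G" "mon G n (gr_vars A R n x) \<beta> \<in> carrier G" for \<beta>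
    using d(1) mon_Gr_aux[of n \<beta>] by auto
  have "left_comb G n (gr_vars A R n x) (\<lambda>\<alpha>. base_emb (d \<alpha>))
    = (\<Oplus>\<^bsub>G\<^esub>\<alpha>\<in>B. base_emb (d \<alpha>) \<otimes>\<^bsub>G\<^esub> mon G n (gr_vars A R n x) \<alpha>)"
    unfolding left_comb_def supp
    by (rule G.add.finprod_mono_neutral_cong_left) (use assms mem gr_elt_zero in auto)
  then show ?thesis using finsum_Gr[OF assms(2,3) d(1)] by simp
qed

lemma coeff_families_Gr:
  assumes "c \<in> coeff_families G (gr_base A R n x) n"
  obtains d where "d \<in> coeff_families A R n" "c = (\<lambda>\<alpha>. base_emb (d \<alpha>))"
proof -
  have "\<exists>r. r \<in> R \<and> c \<alpha> = base_emb r" for \<alpha>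
    using assms unfolding coeff_families_def gr_base_def by blast
  then obtain d where d: "\<And>\<alpha>. d \<alpha> \<in> R" "\<And>\<alpha>. c \<alpha> = base_emb (d \<alpha>)" by metis
  then have "{\<alpha>. d \<alpha> \<noteq> \<zero>} = {\<alpha>. c \<alpha> \<noteq> \<zero>\<^bsub>G\<^esub>}" by (simp add: base_emb_eq_zero_iff)
  then have "d \<in> coeff_families A R n" using assms d(1) unfolding coeff_families_def by auto
  then show ?thesis using that d(2) by blast
qed

lemma coeff_families_base_emb:
  "d \<in> coeff_families A R n \<Longrightarrow> (\<lambda>\<alpha>. base_emb (d \<alpha>)) \<in> coeff_families G (gr_base A R n x) n"
  unfolding coeff_families_def gr_base_def by (auto simp: base_emb_eq_zero_iff range_subsetD)

lemma cls_left_comb: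
  assumes a: "a \<in> rees"
  shows "cls a = left_comb G n (gr_vars A R n x) (\<lambda>\<alpha>. base_emb (gr_coef a \<alpha>))"
proof -
  note d = gr_coef_families[OF a]
  have "{\<alpha>. gr_coef a \<alpha> \<noteq> \<zero>} \<subseteq> mexps n" using coeff_familiesD(2)[OF d] by blast
  then show ?thesis
    using left_comb_Gr[OF d coeff_familiesD(3)[OF d]] cls_graded_comb[OF a] by simp
qed

lemma skew_PBW_Gr: "skew_PBW G (gr_base A R n x) n (gr_vars A R n x)"
proof -
  interpret G: ring G by (rule ring_Gr)
  interpret S: subring "gr_base A R n x" G by (rule gr_base_subring)
  show ?thesis
  proof
    fix i assume "i < n"
    then show "gr_vars A R n x i \<in> carrier G" by (simp add: gr_vars_eq vars_filt)
  next
    fix u assume "u \<in> carrier G"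
    then obtain a where a: "a \<in> rees" "u = cls a" using carrier_Gr by auto
    let ?d = "gr_coef a" and ?X = "gr_vars A R n x"
    note d = gr_coef_families[OF a(1)]
    have "u = left_comb G n ?X (\<lambda>\<alpha>. base_emb (?d \<alpha>))"
      using cls_left_comb a by simp
    moreover have "c = (\<lambda>\<alpha>. base_emb (?d \<alpha>))"
      if c: "c \<in> coeff_families G (gr_base A R n x) n" "u = left_comb G n ?X c" for c
    proof -
      obtain e where e: "e \<in> coeff_families A R n" "c = (\<lambda>\<alpha>. base_emb (e \<alpha>))"
        using coeff_families_Gr[OF c(1)] .
      \<comment> \<open>The union of both supports, so that both expansions become graded
        combinations over the same set.\<close>
      let ?B = "{\<alpha>. ?d \<alpha> \<noteq> \<zero>} \<union> {\<alpha>. e \<alpha> \<noteq> \<zero>}"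
      have B: "finite ?B" "?B \<subseteq> mexps n" using d e(1) by (auto simp: coeff_families_def)
      have eq: "cls (graded_comb ?d ?B) = cls (graded_comb e ?B)"
        using left_comb_Gr[OF d B] left_comb_Gr[OF e(1) B] calculation c(2) e(2) by simp
      have "?d \<alpha> = e \<alpha>" if "\<alpha> \<in> ?B" for \<alpha>
        by (rule cls_graded_comb_inject[where d = ?d and d' = e,
            OF B coeff_familiesD(1)[OF d] coeff_familiesD(1)[OF e(1)] eq that])
      moreover have "?d \<alpha> = e \<alpha>" if "\<alpha> \<notin> ?B" for \<alpha> using that by simp
      ultimately have "?d = e" by blast
      then show ?thesis using e(2) by simp
    qed
    ultimately show "\<exists>!c. c \<in> coeff_families G (gr_base A R n x) n \<and> u = left_comb G n ?X c"
      using coeff_families_base_emb[OF d] by blast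
  next
    fix i \<rho> assume i: "i < n" and "\<rho> \<in> gr_base A R n x - {\<zero>\<^bsub>G\<^esub>}"
    then obtain r where r: "r \<in> R" "\<rho> = base_emb r" "r \<noteq> \<zero>"
      unfolding gr_base_def using gr_elt_zero by auto
    obtain s d where s: "s \<in> R" "d \<in> R" "x i \<otimes> r = s \<otimes> x i \<oplus> d" "s \<noteq> \<zero>"
      using var_scalar_ex[OF i r(1)] r(3) by blast
    have rF: "r \<in> F (int 0)" using r(1) by simp
    have sx: "s \<otimes> x i \<in> F 1" using s(1) vars_filt[OF i] by (rule filt_smult)
    have xr: "x i \<otimes> r \<in> F 1" using filt_mult[OF vars_filt[OF i] rF] by simp
    \<comment> \<open>The defect lies in R = F 0 and hence disappears in the component of degree
      1.\<close>
    have "x i \<otimes> r \<ominus> s \<otimes> x i \<in> F 0"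
      using s vars[OF i] by (simp add: a_minus_def a_assoc a_comm[of _ "\<ominus> (s \<otimes> x i)"] r_neg1)
    then have "gr_vars A R n x i \<otimes>\<^bsub>G\<^esub> \<rho> = base_emb s \<otimes>\<^bsub>G\<^esub> gr_vars A R n x i"
      using i s(1) vars_filt[OF i] gr_elt_mult[of "x i" 1 r 0] rF gr_elt_eq_iff[of "x i \<otimes> r" 1 "s \<otimes> x i"] sx xr
      by (simp add: gr_vars_eq r(2) base_emb_mult)
    moreover have "base_emb s \<in> gr_base A R n x - {\<zero>\<^bsub>G\<^esub>}"
      using s by (simp add: gr_base_def base_emb_eq_zero_iff)
    moreover have "base_emb s \<otimes>\<^bsub>G\<^esub> gr_vars A R n x i \<in> carrier G"
      using i s(1) vars_filt[OF i] by (simp add: gr_vars_eq)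
    then have "base_emb s \<otimes>\<^bsub>G\<^esub> gr_vars A R n x i \<ominus>\<^bsub>G\<^esub> base_emb s \<otimes>\<^bsub>G\<^esub> gr_vars A R n x i = \<zero>\<^bsub>G\<^esub>"
      by (simp add: G.r_neg G.minus_eq)
    ultimately show "\<exists>c\<in>gr_base A R n x - {\<zero>\<^bsub>G\<^esub>}.
        gr_vars A R n x i \<otimes>\<^bsub>G\<^esub> \<rho> \<ominus>\<^bsub>G\<^esub> c \<otimes>\<^bsub>G\<^esub> gr_vars A R n x i \<in> gr_base A R n x"
      using subringE(2)[OF gr_base_subring] by (metis)
  next
    fix i j assume i: "i < n" and j: "j < n"
    let ?X = "gr_vars A R n x"
    obtain c where c: "c \<in> R" "c \<noteq> \<zero>" "x j \<otimes> x i \<ominus> c \<otimes> (x i \<otimes> x j) \<in> F 1"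
      using comm_vars[OF i j] affine_span_filt by auto
    have m: "x i \<otimes> x j \<in> F (int 2)" "x j \<otimes> x i \<in> F (int 2)"
      using filt_mult[OF vars_filt[OF i] vars_filt[OF j]] filt_mult[OF vars_filt[OF j] vars_filt[OF i]] by simp_all
    have "?X j \<otimes>\<^bsub>G\<^esub> ?X i = E 2 (x j \<otimes> x i)" "?X i \<otimes>\<^bsub>G\<^esub> ?X j = E 2 (x i \<otimes> x j)"
      using i j vars_filt gr_elt_mult[of "x i" 1 "x j" 1] gr_elt_mult[of "x j" 1 "x i" 1]
      by (simp_all add: gr_vars_eq numeral_2_eq_2)
    \<comment> \<open>The defect lies in F 1, and these products live in degree 2, where F 1 is
      divided out.\<close>
    then have eq: "?X j \<otimes>\<^bsub>G\<^esub> ?X i = base_emb c \<otimes>\<^bsub>G\<^esub> (?X i \<otimes>\<^bsub>G\<^esub> ?X j)"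
      using c m gr_elt_eq_iff[OF m(2) filt_smult[OF c(1) m(1)]] by (simp add: base_emb_mult)
    have X: "?X k \<in> carrier G" if "k < n" for k using that by (simp add: gr_vars_eq vars_filt)
    have "\<zero>\<^bsub>G\<^esub> = \<zero>\<^bsub>G\<^esub> \<oplus>\<^bsub>G\<^esub> (\<Oplus>\<^bsub>G\<^esub>i\<in>{..<n}. \<zero>\<^bsub>G\<^esub> \<otimes>\<^bsub>G\<^esub> ?X i)"
    proof -
      have "(\<Oplus>\<^bsub>G\<^esub>i\<in>{..<n}. \<zero>\<^bsub>G\<^esub> \<otimes>\<^bsub>G\<^esub> ?X i) = (\<Oplus>\<^bsub>G\<^esub>i\<in>{..<n}. \<zero>\<^bsub>G\<^esub>)"
        using X by (intro G.finsum_cong') auto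
      then show ?thesis by simp
    qed
    then have "\<zero>\<^bsub>G\<^esub> \<in> affine_span G (gr_base A R n x) n ?X"
      unfolding affine_span_def using subringE(2)[OF gr_base_subring]
      by (intro CollectI exI[of _ "\<zero>\<^bsub>G\<^esub>"] exI[of _ "\<lambda>_. \<zero>\<^bsub>G\<^esub>"]) simp
    moreover have "base_emb c \<otimes>\<^bsub>G\<^esub> (?X i \<otimes>\<^bsub>G\<^esub> ?X j) \<in> carrier G" using c X[OF i] X[OF j] by simp
    then have "?X j \<otimes>\<^bsub>G\<^esub> ?X i \<ominus>\<^bsub>G\<^esub> base_emb c \<otimes>\<^bsub>G\<^esub> (?X i \<otimes>\<^bsub>G\<^esub> ?X j) = \<zero>\<^bsub>G\<^esub>"
      unfolding eq by (simp add: G.r_neg G.minus_eq)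
    moreover have "base_emb c \<in> gr_base A R n x - {\<zero>\<^bsub>G\<^esub>}"
      using c by (simp add: gr_base_def base_emb_eq_zero_iff)
    ultimately show "\<exists>c\<in>gr_base A R n x - {\<zero>\<^bsub>G\<^esub>}.
        ?X j \<otimes>\<^bsub>G\<^esub> ?X i \<ominus>\<^bsub>G\<^esub> c \<otimes>\<^bsub>G\<^esub> (?X i \<otimes>\<^bsub>G\<^esub> ?X j) \<in> affine_span G (gr_base A R n x) n ?X"
      by metis
  qed
qed

lemma nontrivial_Gr: "nontrivial_skew_PBW G (gr_base A R n x) n (gr_vars A R n x)"
  using skew_PBW_Gr base_emb_eq_zero_iff[of \<one>] one_neq_zero
  by (simp add: nontrivial_skew_PBW_def nontrivial_skew_PBW_axioms_def gr_elt_one)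

subsection \<open>Leading terms and ideals\<close>

abbreviation Gbase :: "(nat \<Rightarrow> 'a set) set" where
  "Gbase \<equiv> gr_base A R n x"

abbreviation Gvars :: "nat \<Rightarrow> nat \<Rightarrow> 'a set" where
  "Gvars \<equiv> gr_vars A R n x"

text \<open>All results obtained for A now apply to Gr(A) itself, in particular the uniqueness of
  coefficients, of sigma and c, and of leading terms.\<close>

interpretation GR: nontrivial_skew_PBW G Gbase n Gvars
  by (rule nontrivial_Gr)

lemma coeff_of_cls:
  "a \<in> rees \<Longrightarrow> coeff_of G Gbase n Gvars (cls a) = (\<lambda>\<alpha>. base_emb (gr_coef a \<alpha>))"
  using cls_left_comb GR.coef_left_comb[OF coeff_families_base_emb[OF gr_coef_families]] by simp

lemma coeff_of_cls_eq_zero_iff: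
  "a \<in> rees \<Longrightarrow> coeff_of G Gbase n Gvars (cls a) \<alpha> = \<zero>\<^bsub>G\<^esub> \<longleftrightarrow> gr_coef a \<alpha> = \<zero>"
  using coeff_familiesD(1)[OF gr_coef_families] by (simp add: coeff_of_cls base_emb_eq_zero_iff)

lemma pbw_deg_filt:
  assumes "f \<in> carrier A" "f \<noteq> \<zero>"
  shows "f \<in> F (int (pbw_deg A R n x f))" "f \<notin> F (int (pbw_deg A R n x f) - 1)"
proof -
  show "f \<in> F (int (pbw_deg A R n x f))"
    using pbw_deg_le_iff[OF assms, of "int (pbw_deg A R n x f)"] assms by (simp add: filt_iff)
  show "f \<notin> F (int (pbw_deg A R n x f) - 1)"
    using pbw_deg_le_iff[OF assms, of "int (pbw_deg A R n x f) - 1"] assms by (simp add: filt_iff)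
qed

lemma symb_closed: "f \<in> carrier A \<Longrightarrow> f \<noteq> \<zero> \<Longrightarrow> symb A R n x f \<in> carrier G"
  by (simp add: symb_def pbw_deg_filt)

lemma symb_nonzero: "f \<in> carrier A \<Longrightarrow> f \<noteq> \<zero> \<Longrightarrow> symb A R n x f \<noteq> \<zero>\<^bsub>G\<^esub>"
  by (simp add: symb_def pbw_deg_filt gr_elt_eq_zero_iff)

lemma homogeneous_symb: "f \<in> carrier A \<Longrightarrow> f \<noteq> \<zero> \<Longrightarrow> homogeneous A R n x (symb A R n x f)"
  unfolding homogeneous_def
  by (intro conjI symb_closed exI[of _ "pbw_deg A R n x f"]) (auto simp: symb_def gr_elt_def gr_part_facts(3))

lemma symb_M:
  assumes "\<alpha> \<in> mexps n"
  shows "symb A R n x (M \<alpha>) = GR.M \<alpha>"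
proof -
  have "supp_of A R n x (M \<alpha>) = {\<alpha>}" using one_neq_zero by (auto simp: supp_of_def coef_M assms)
  then show ?thesis by (simp add: symb_def pbw_deg_def mon_Gr)
qed

section \<open>Transfer of the monomial order\<close>

lemma gr_order_iff:
  assumes "\<alpha> \<in> mexps n" "\<beta> \<in> mexps n"
  shows "(GR.M \<alpha>, GR.M \<beta>) \<in> gr_order A R n x S \<longleftrightarrow> (M \<alpha>, M \<beta>) \<in> S"
proof
  assume "(GR.M \<alpha>, GR.M \<beta>) \<in> gr_order A R n x S"
  then obtain \<alpha>' \<beta>' where *: "\<alpha>' \<in> mexps n" "\<beta>' \<in> mexps n" "GR.M \<alpha> = symb A R n x (M \<alpha>')"
    "GR.M \<beta> = symb A R n x (M \<beta>')" "(M \<alpha>', M \<beta>') \<in> S"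
    unfolding gr_order_def Mon_def by blast
  then have "\<alpha> = \<alpha>'" "\<beta> = \<beta>'" using assms by (simp_all add: symb_M GR.M_inject)
  then show "(M \<alpha>, M \<beta>) \<in> S" using * by simp
next
  assume "(M \<alpha>, M \<beta>) \<in> S"
  then show "(GR.M \<alpha>, GR.M \<beta>) \<in> gr_order A R n x S"
    unfolding gr_order_def symb_M[OF assms(1), symmetric] symb_M[OF assms(2), symmetric]
    using assms by (auto simp: Mon_def)
qed

lemma gr_order_subset: "gr_order A R n x S \<subseteq> Mon G n Gvars \<times> Mon G n Gvars"
  by (auto simp: gr_order_def Mon_def symb_M)

lemma linear_order_gr_order:
  assumes S: "linear_order_on (Mon A n x) S"
  shows "linear_order_on (Mon G n Gvars) (gr_order A R n x S)"
  unfolding order_on_defs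
proof (intro conjI)
  have mem: "u \<in> Mon G n Gvars \<Longrightarrow> \<exists>\<alpha>. \<alpha> \<in> mexps n \<and> u = GR.M \<alpha>" for u by (auto simp: Mon_def)
  have sub: "(u, v) \<in> gr_order A R n x S \<Longrightarrow>
      \<exists>\<alpha> \<beta>. \<alpha> \<in> mexps n \<and> \<beta> \<in> mexps n \<and> u = GR.M \<alpha> \<and> v = GR.M \<beta>" for u v
    using gr_order_subset mem by blast
  have S': "refl_on (Mon A n x) S" "trans S" "antisym S" "total_on (Mon A n x) S"
    using S by (simp_all add: order_on_defs)
  show "gr_order A R n x S \<subseteq> Mon G n Gvars \<times> Mon G n Gvars" by (rule gr_order_subset)
  show "refl_on (Mon G n Gvars) (gr_order A R n x S)"
    using S'(1) by (auto simp: refl_on_def Mon_def gr_order_iff)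
  show "trans (gr_order A R n x S)"
    by (rule transI) (metis S'(2) GR.M_inject gr_order_iff sub transD)
  show "antisym (gr_order A R n x S)"
    by (rule antisymI) (metis S'(3) GR.M_inject M_inject gr_order_iff sub antisymD)
  show "total_on (Mon G n Gvars) (gr_order A R n x S)"
    using S'(4) by (auto simp: total_on_def Mon_def gr_order_iff M_inject)
qed

lemma monomial_orderD:
  assumes "monomial_order A R n x S"
  shows "linear_order_on (Mon A n x) S"
    and "\<alpha> \<in> mexps n \<Longrightarrow> \<beta> \<in> mexps n \<Longrightarrow> mdeg n \<beta> > mdeg n \<alpha> \<Longrightarrow> (M \<beta>, M \<alpha>) \<in> S"
  using assms by (auto simp: monomial_order_def)

text \<open>Compatibility with products transfers because, in both rings, the leading monomial of a
  triple product of monomials has the sum of the exponents. The comparison thus involves the same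
  pair of exponents on both sides.\<close>

lemma monomial_order_gr_order:
  assumes S: "monomial_order A R n x S"
  shows "monomial_order G Gbase n Gvars (gr_order A R n x S)"
proof -
  note lin = monomial_orderD(1)[OF S] and deg = monomial_orderD(2)[OF S]
  note Glin = linear_order_gr_order[OF lin]
  have Gdeg: "(GR.M \<beta>, GR.M \<alpha>) \<in> gr_order A R n x S"
    if "\<alpha> \<in> mexps n" "\<beta> \<in> mexps n" "mdeg n \<beta> > mdeg n \<alpha>" for \<alpha> \<beta>
    using that deg by (simp add: gr_order_iff)
  show ?thesis
    unfolding monomial_order_def
  proof (intro conjI ballI impI)
    fix u v w z
    assume mem: "u \<in> Mon G n Gvars" "v \<in> Mon G n Gvars" "w \<in> Mon G n Gvars" "z \<in> Mon G n Gvars"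
      and vu: "(v, u) \<in> gr_order A R n x S"
    obtain \<alpha> \<beta> \<gamma> \<delta> where e: "\<alpha> \<in> mexps n" "\<beta> \<in> mexps n" "\<gamma> \<in> mexps n" "\<delta> \<in> mexps n"
      and eq: "u = GR.M \<alpha>" "v = GR.M \<beta>" "w = GR.M \<gamma>" "z = GR.M \<delta>" using mem by (auto simp: Mon_def)
    have "(M \<beta>, M \<alpha>) \<in> S" using vu e by (simp add: eq gr_order_iff)
    then have "(lm A R n x S (M \<gamma> \<otimes> M \<beta> \<otimes> M \<delta>), lm A R n x S (M \<gamma> \<otimes> M \<alpha> \<otimes> M \<delta>)) \<in> S"
      using S e unfolding monomial_order_def Mon_def by blast
    then show "(lm G Gbase n Gvars (gr_order A R n x S) (w \<otimes>\<^bsub>G\<^esub> v \<otimes>\<^bsub>G\<^esub> z),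
        lm G Gbase n Gvars (gr_order A R n x S) (w \<otimes>\<^bsub>G\<^esub> u \<otimes>\<^bsub>G\<^esub> z)) \<in> gr_order A R n x S"
      unfolding eq
      using e lm_M_mult3[OF lin deg] GR.lm_M_mult3[OF Glin Gdeg] by (simp add: gr_order_iff madd_mexps)
  next
    fix u assume "u \<in> Mon G n Gvars"
    then obtain \<alpha> where \<alpha>: "\<alpha> \<in> mexps n" "u = GR.M \<alpha>" by (auto simp: Mon_def)
    have "(M \<alpha>, M (\<lambda>_. 0)) \<in> S" using S \<alpha> by (simp add: monomial_order_def Mon_def)
    then show "(u, \<one>\<^bsub>G\<^esub>) \<in> gr_order A R n x S"
      using gr_order_iff[OF \<alpha>(1) zero_mexps, of S] \<alpha>(2) by simp
  next
    fix \<alpha> \<beta> assume *: "\<alpha> \<in> mexps n" "\<beta> \<in> mexps n" "mdeg n \<alpha> < mdeg n \<beta>"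
    then show "GR.M \<beta> \<noteq> GR.M \<alpha>" by (auto simp: GR.M_inject)
    show "(GR.M \<beta>, GR.M \<alpha>) \<in> gr_order A R n x S" using Gdeg * .
  qed (rule Glin)
qed

text \<open>A term of larger degree would be above the leading one by degree and below it by
  maximality, hence equal to it by antisymmetry.\<close>

lemma lead_ex_deg:
  assumes S: "monomial_order A R n x S" and f: "f \<in> carrier A" "f \<noteq> \<zero>"
  obtains \<alpha> where "coef f \<alpha> \<noteq> \<zero>" "\<And>\<beta>. coef f \<beta> \<noteq> \<zero> \<Longrightarrow> (M \<alpha>, M \<beta>) \<in> S"
    "\<And>\<beta>. coef f \<beta> \<noteq> \<zero> \<Longrightarrow> mdeg n \<beta> \<le> mdeg n \<alpha>"
proof -
  note lin = monomial_orderD(1)[OF S]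
  have anti: "antisym S" using lin by (simp add: order_on_defs)
  obtain \<alpha> where \<alpha>: "coef f \<alpha> \<noteq> \<zero>" "\<And>\<beta>. coef f \<beta> \<noteq> \<zero> \<Longrightarrow> (M \<alpha>, M \<beta>) \<in> S"
    using lead_ex[OF lin f] by blast
  have "mdeg n \<beta> \<le> mdeg n \<alpha>" if "coef f \<beta> \<noteq> \<zero>" for \<beta>
  proof (rule ccontr)
    assume "\<not> mdeg n \<beta> \<le> mdeg n \<alpha>"
    moreover have mex: "\<alpha> \<in> mexps n" "\<beta> \<in> mexps n" using \<alpha>(1) that coef_mexps[OF f(1)] by auto
    ultimately have "(M \<beta>, M \<alpha>) \<in> S" using monomial_orderD(2)[OF S] by simp
    then have "\<alpha> = \<beta>" using antisymD[OF anti] \<alpha>(2)[OF that] M_inject[OF mex] by blast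
    then show False using \<open>\<not> mdeg n \<beta> \<le> mdeg n \<alpha>\<close> by simp
  qed
  then show ?thesis using that \<alpha> by blast
qed

text \<open>
  The leading term of an element of \<open>Gr(A)\<close> sits in its top component, so it is the leading
  term of any representative of that component.
\<close>

lemma lead_cls:
  assumes S: "monomial_order A R n x S" and a: "a \<in> rees" "a p \<notin> F (int p - 1)"
    and top: "\<forall>q>p. a q \<in> F (int q - 1)"
  shows "mexp G n Gvars (lm G Gbase n Gvars (gr_order A R n x S) (cls a)) = mexp A n x (lm A R n x S (a p))"
    "lc G Gbase n Gvars (gr_order A R n x S) (cls a) = base_emb (lc A R n x S (a p))"
proof -
  note lin = monomial_orderD(1)[OF S]
  have f: "a p \<in> carrier A" "a p \<noteq> \<zero>" using a by auto
  obtain \<alpha> where \<alpha>: "coef (a p) \<alpha> \<noteq> \<zero>" "\<And>\<beta>. coef (a p) \<beta> \<noteq> \<zero> \<Longrightarrow> (M \<alpha>, M \<beta>) \<in> S"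
    "\<And>\<beta>. coef (a p) \<beta> \<noteq> \<zero> \<Longrightarrow> mdeg n \<beta> \<le> mdeg n \<alpha>"
    using lead_ex_deg[OF S f] by blast
  \<comment> \<open>Since a p lies outside F (p - 1), some term has degree at least p, and the
    leading term has maximal degree.\<close>
  have \<alpha>p: "mdeg n \<alpha> = p"
  proof (rule antisym)
    show "mdeg n \<alpha> \<le> p" using reesD(1)[OF a(1), of p] \<alpha>(1) by (auto simp: filt_iff)
    obtain \<beta> where "coef (a p) \<beta> \<noteq> \<zero>" "\<not> int (mdeg n \<beta>) \<le> int p - 1"
      using a(2) f(1) unfolding filt_iff by blast
    then show "p \<le> mdeg n \<alpha>" using \<alpha>(3)[of \<beta>] by simp
  qed
  have mex: "\<alpha> \<in> mexps n" using coef_mexps[OF f(1) \<alpha>(1)] .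
  have gc: "gr_coef a \<alpha> = coef (a p) \<alpha>" by (simp add: gr_coef_def \<alpha>p)
  have "(M \<alpha>, M \<beta>) \<in> S \<and> \<beta> \<in> mexps n" if "gr_coef a \<beta> \<noteq> \<zero>" for \<beta>
  proof -
    let ?q = "mdeg n \<beta>"
    have nz: "coef (a ?q) \<beta> \<noteq> \<zero>" using that by (simp add: gr_coef_def)
    then have "\<beta> \<in> mexps n" using coef_mexps[OF rees_carrier[OF a(1)]] by blast
    \<comment> \<open>A coefficient that survives in Gr(A) shows that its component is nonzero
      there, so its degree q is at most p. For q < p the degree decides the comparison, and for q =
      p the maximality in a p does.\<close>
    moreover have "a ?q \<notin> F (int ?q - 1)" using nz by (auto simp: filt_iff)
    then have "?q \<le> p" using top not_le by blast
    then have "(M \<alpha>, M \<beta>) \<in> S"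
      using nz \<alpha>(2)[of \<beta>] monomial_orderD(2)[OF S calculation mex] \<alpha>p by (cases "?q = p") auto
    ultimately show ?thesis by blast
  qed
  then have Gmax: "(GR.M \<alpha>, GR.M \<beta>) \<in> gr_order A R n x S"
    if "coeff_of G Gbase n Gvars (cls a) \<beta> \<noteq> \<zero>\<^bsub>G\<^esub>" for \<beta>
    using that mex a(1) by (simp add: coeff_of_cls_eq_zero_iff gr_order_iff)
  have "cls a \<in> carrier G" using a(1) carrier_Gr by auto
  moreover have "coeff_of G Gbase n Gvars (cls a) \<alpha> \<noteq> \<zero>\<^bsub>G\<^esub>"
    using a(1) \<alpha>(1) gc by (simp add: coeff_of_cls_eq_zero_iff)
  ultimately show "mexp G n Gvars (lm G Gbase n Gvars (gr_order A R n x S) (cls a)) = mexp A n x (lm A R n x S (a p))"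
    "lc G Gbase n Gvars (gr_order A R n x S) (cls a) = base_emb (lc A R n x S (a p))"
    using GR.lead_eqI(2,3)[OF linear_order_gr_order[OF lin], of "cls a" \<alpha>, OF _ _ Gmax]
      lead_eqI(2,3)[OF lin f(1) \<alpha>(1,2)] coeff_of_cls[OF a(1)] gc
    by simp_all
qed

lemma lead_symb:
  assumes S: "monomial_order A R n x S" and f: "f \<in> carrier A" "f \<noteq> \<zero>"
  shows "mexp G n Gvars (lm G Gbase n Gvars (gr_order A R n x S) (symb A R n x f)) = mexp A n x (lm A R n x S f)"
    "lc G Gbase n Gvars (gr_order A R n x S) (symb A R n x f) = base_emb (lc A R n x S f)"
proof -
  let ?p = "pbw_deg A R n x f" and ?a = "\<lambda>q. if q = pbw_deg A R n x f then f else \<zero>"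
  have symb: "symb A R n x f = cls ?a" "?a \<in> rees"
    using gr_elt_cls[OF pbw_deg_filt(1)[OF f]] by (simp_all add: symb_def)
  show "mexp G n Gvars (lm G Gbase n Gvars (gr_order A R n x S) (symb A R n x f)) = mexp A n x (lm A R n x S f)"
    "lc G Gbase n Gvars (gr_order A R n x S) (symb A R n x f) = base_emb (lc A R n x S f)"
    using lead_cls[OF S symb(2), of ?p] pbw_deg_filt(2)[OF f] by (simp_all add: symb(1))
qed

lemma lc_mexp_closed:
  assumes S: "monomial_order A R n x S" and f: "f \<in> carrier A" "f \<noteq> \<zero>"
  shows "lc A R n x S f \<in> R - {\<zero>}" "mexp A n x (lm A R n x S f) \<in> mexps n"
proof -
  obtain \<alpha> where \<alpha>: "coef f \<alpha> \<noteq> \<zero>" "\<And>\<beta>. coef f \<beta> \<noteq> \<zero> \<Longrightarrow> (M \<alpha>, M \<beta>) \<in> S"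
    using lead_ex[OF monomial_orderD(1)[OF S] f] by blast
  then show "lc A R n x S f \<in> R - {\<zero>}" "mexp A n x (lm A R n x S f) \<in> mexps n"
    using lead_eqI[OF monomial_orderD(1)[OF S] f(1) \<alpha>] f(1) coef_mexps[OF f(1)] by simp_all
qed

section \<open>Transfer of the structure constants and of generated ideals\<close>

lemma pbw_sigma_Gr:
  assumes \<alpha>: "\<alpha> \<in> mexps n" and r: "r \<in> R" "r \<noteq> \<zero>"
  shows "pbw_sigma A R n x \<alpha> r \<in> R"
    "pbw_sigma G Gbase n Gvars \<alpha> (base_emb r) = base_emb (pbw_sigma A R n x \<alpha> r)"
proof -
  obtain s p where s: "s \<in> R" "p \<in> F (int (mdeg n \<alpha>) - 1)" "M \<alpha> \<otimes> r = s \<otimes> M \<alpha> \<oplus> p" "s \<noteq> \<zero>"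
    using M_scalar[OF \<alpha> r(1)] r(2) by blast
  have sig: "pbw_sigma A R n x \<alpha> r = s" using pbw_sigma_eqI[OF \<alpha> s(1,4,2,3)] .
  show "pbw_sigma A R n x \<alpha> r \<in> R" using sig s(1) by simp
  have mem: "M \<alpha> \<in> F (int (mdeg n \<alpha>))" using \<alpha> by (rule filt_M) simp
  have sM: "s \<otimes> M \<alpha> \<in> F (int (mdeg n \<alpha>))" using s(1) mem by (rule filt_smult)
  have p: "p \<in> F (int (mdeg n \<alpha>))" using s(2) by (rule filt_mono) simp
  have p0: "E (mdeg n \<alpha>) p = \<zero>\<^bsub>G\<^esub>" using gr_elt_eq_zero_iff[OF p] s(2) by blast
  have "GR.M \<alpha> \<otimes>\<^bsub>G\<^esub> base_emb r = E (mdeg n \<alpha>) (M \<alpha> \<otimes> r)"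
    using gr_elt_mult[OF mem, of r 0] r(1) by (simp add: mon_Gr)
  also have "\<dots> = E (mdeg n \<alpha>) (s \<otimes> M \<alpha>) \<oplus>\<^bsub>G\<^esub> E (mdeg n \<alpha>) p"
    unfolding s(3) using sM p by (simp add: gr_elt_add)
  also have "\<dots> = base_emb s \<otimes>\<^bsub>G\<^esub> GR.M \<alpha> \<oplus>\<^bsub>G\<^esub> \<zero>\<^bsub>G\<^esub>"
    unfolding p0 using base_emb_mult[OF s(1) mem] by (simp add: mon_Gr)
  finally have "GR.M \<alpha> \<otimes>\<^bsub>G\<^esub> base_emb r = \<dots>" .
  moreover have "base_emb s \<in> Gbase" "base_emb s \<noteq> \<zero>\<^bsub>G\<^esub>"
    using s by (simp_all add: gr_base_def base_emb_eq_zero_iff)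
  ultimately show "pbw_sigma G Gbase n Gvars \<alpha> (base_emb r) = base_emb (pbw_sigma A R n x \<alpha> r)"
    unfolding sig using GR.pbw_sigma_eqI[OF \<alpha> _ _ GR.filt_zero] by blast
qed

lemma pbw_c_Gr:
  assumes \<alpha>: "\<alpha> \<in> mexps n" "\<beta> \<in> mexps n"
  shows "pbw_c A R n x \<alpha> \<beta> \<in> R"
    "pbw_c G Gbase n Gvars \<alpha> \<beta> = base_emb (pbw_c A R n x \<alpha> \<beta>)"
proof -
  let ?\<gamma> = "madd \<alpha> \<beta>"
  obtain c p where c: "linv c" "p \<in> F (int (mdeg n ?\<gamma>) - 1)" "M \<alpha> \<otimes> M \<beta> = c \<otimes> M ?\<gamma> \<oplus> p"
    using M_mult[OF \<alpha>] by blast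
  have pc: "pbw_c A R n x \<alpha> \<beta> = c" using pbw_c_eqI[OF \<alpha> c] .
  have cR: "c \<in> R" using c(1) by simp
  show "pbw_c A R n x \<alpha> \<beta> \<in> R" using pc cR by simp
  have mem: "M \<gamma> \<in> F (int (mdeg n \<gamma>))" if "\<gamma> \<in> mexps n" for \<gamma> using that by (rule filt_M) simp
  note mem\<gamma> = mem[OF madd_mexps[OF \<alpha>]]
  have cM: "c \<otimes> M ?\<gamma> \<in> F (int (mdeg n ?\<gamma>))" using cR mem\<gamma> by (rule filt_smult)
  have p: "p \<in> F (int (mdeg n ?\<gamma>))" using c(2) by (rule filt_mono) simp
  have p0: "E (mdeg n ?\<gamma>) p = \<zero>\<^bsub>G\<^esub>" using gr_elt_eq_zero_iff[OF p] c(2) by blast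
  have "GR.M \<alpha> \<otimes>\<^bsub>G\<^esub> GR.M \<beta> = E (mdeg n ?\<gamma>) (M \<alpha> \<otimes> M \<beta>)"
    using gr_elt_mult[OF mem[OF \<alpha>(1)] mem[OF \<alpha>(2)]] by (simp add: mon_Gr)
  also have "\<dots> = E (mdeg n ?\<gamma>) (c \<otimes> M ?\<gamma>) \<oplus>\<^bsub>G\<^esub> E (mdeg n ?\<gamma>) p"
    unfolding c(3) using gr_elt_add[OF cM p] by simp
  also have "\<dots> = base_emb c \<otimes>\<^bsub>G\<^esub> GR.M ?\<gamma> \<oplus>\<^bsub>G\<^esub> \<zero>\<^bsub>G\<^esub>"
    unfolding p0 using base_emb_mult[OF cR mem\<gamma>] by (simp only: mon_Gr)
  finally have "GR.M \<alpha> \<otimes>\<^bsub>G\<^esub> GR.M \<beta> = \<dots>" .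
  moreover obtain d where d: "d \<in> R" "d \<otimes> c = \<one>" using c(1) unfolding linv_def by blast
  have "GR.linv (base_emb c)"
    unfolding GR.linv_def
  proof (intro conjI bexI[of _ "base_emb d"])
    show "base_emb d \<otimes>\<^bsub>G\<^esub> base_emb c = \<one>\<^bsub>G\<^esub>" using d cR by (simp add: base_emb_simps gr_elt_one)
  qed (use d cR in \<open>simp_all add: gr_base_def\<close>)
  ultimately show "pbw_c G Gbase n Gvars \<alpha> \<beta> = base_emb (pbw_c A R n x \<alpha> \<beta>)"
    unfolding pc using GR.pbw_c_eqI[OF \<alpha> _ GR.filt_zero] by blast
qed

text \<open>The preimage under \<open>base_emb\<close> of a left ideal of the image is a left ideal
  of R. If the ideal contains the images of T, the preimage contains T and hence r.\<close>

lemma gen_left_ideal_base_emb: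
  assumes "T \<subseteq> R" "r \<in> R" and r: "r \<in> gen_left_ideal (A\<lparr>carrier := R\<rparr>) T"
  shows "base_emb r \<in> gen_left_ideal (G\<lparr>carrier := Gbase\<rparr>) (base_emb ` T)"
  unfolding gen_left_ideal_def
proof (rule InterI, clarify)
  fix I assume I: "left_ideal I (G\<lparr>carrier := Gbase\<rparr>)" "base_emb ` T \<subseteq> I"
  interpret I: additive_subgroup I "G\<lparr>carrier := Gbase\<rparr>" using I(1) by (simp add: left_ideal_def)
  have I_mult: "base_emb s \<otimes>\<^bsub>G\<^esub> u \<in> I" if "s \<in> R" "u \<in> I" for s u
    using I(1) that by (auto simp: left_ideal_def gr_base_def)
  interpret RR: ring "A\<lparr>carrier := R\<rparr>" using subring_is_ring[OF subring_axioms] .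
  let ?J = "{s \<in> R. base_emb s \<in> I}"
  have J_mult: "s \<otimes> t \<in> ?J" if "s \<in> R" "t \<in> ?J" for s t
    using I_mult[of s "base_emb t"] that by (auto simp: base_emb_simps R_closed)
  have "subgroup ?J (add_monoid (A\<lparr>carrier := R\<rparr>))"
  proof (rule RR.add.subgroupI)
    show "?J \<noteq> {}" using I.zero_closed gr_elt_zero[of 0] by (auto intro!: exI[of _ \<zero>])
    fix s assume s: "s \<in> ?J"
    \<comment> \<open>The inverse in the restricted structure is a different term and must be
      identified with the ambient one; closure then follows by multiplying with -1.\<close>
    have "\<ominus>\<^bsub>A\<lparr>carrier := R\<rparr>\<^esub> s = \<ominus> s" using s by (intro RR.minus_equality) (auto simp: l_neg R_closed)
    then show "\<ominus>\<^bsub>A\<lparr>carrier := R\<rparr>\<^esub> s \<in> ?J" using J_mult[of "\<ominus> \<one>" s] s by (simp add: R_closed l_minus)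
    fix t assume t: "t \<in> ?J"
    show "s \<oplus>\<^bsub>A\<lparr>carrier := R\<rparr>\<^esub> t \<in> ?J"
      using I.a_closed[of "base_emb s" "base_emb t"] s t by (auto simp: base_emb_simps R_closed)
  qed auto
  then have "left_ideal ?J (A\<lparr>carrier := R\<rparr>)"
    unfolding left_ideal_def using J_mult by (auto intro: additive_subgroupI)
  moreover have "T \<subseteq> ?J" using assms(1) I(2) by auto
  ultimately show "base_emb r \<in> I" using r unfolding gen_left_ideal_def by blast
qed

lemma neg_Gr:
  assumes "a \<in> rees"
  shows "\<ominus>\<^bsub>G\<^esub> cls a = cls (\<lambda>p. \<ominus> a p)"
proof (rule GR.minus_equality)
  show "cls (\<lambda>p. \<ominus> a p) \<oplus>\<^bsub>G\<^esub> cls a = \<zero>\<^bsub>G\<^esub>"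
    using assms rees_neg[OF assms] by (simp add: add_Gr l_neg cls_zero)
qed (use assms rees_neg[OF assms] in \<open>simp_all add: carrier_Gr\<close>)

section \<open>The graded ideal and reduction in it\<close>

context
  fixes I :: "'a set"
  assumes I: "left_ideal I A"
begin

interpretation I: additive_subgroup I A
  using I by (simp add: left_ideal_def)

lemma gr_ideal_eq: "gr_ideal A R n x I = cls ` {a \<in> rees. \<forall>p. a p \<in> I}"
proof -
  let ?L = "\<lambda>p. (I <+> F (int p - 1)) \<inter> F (int p)"
  have "additive_subgroup (?L p) A" for p
    using add_additive_subgroups[OF I.is_additive_subgroup filt_additive_subgroup[of "int p - 1"]]
      filt_additive_subgroup[of "int p"]
    by (simp add: additive_subgroup_def add.subgroups_Inter_pair)
  moreover have "F (int p - 1) \<subseteq> ?L p" for p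
  proof
    fix f assume f: "f \<in> F (int p - 1)"
    then have "\<zero> \<oplus> f \<in> I <+> F (int p - 1)" unfolding set_add_def' using I.zero_closed by blast
    then show "f \<in> ?L p" using f filt_mono[OF f, of "int p"] by simp
  qed
  ultimately have "gr_ideal A R n x I = cls ` {a \<in> rees. \<forall>p. a p \<in> ?L p}"
    unfolding gr_ideal_def by (rule sum_group_cosets) auto
  also have "\<dots> = cls ` {a \<in> rees. \<forall>p. a p \<in> I}"
  proof (intro subset_antisym image_subsetI)
    fix a assume "a \<in> {a \<in> rees. \<forall>p. a p \<in> ?L p}"
    then have a: "a \<in> rees" "\<And>p. a p \<in> I <+> F (int p - 1)" by auto
    \<comment> \<open>Again zero is kept wherever a p is zero, so that the new family has finite
      support.\<close>
    have "\<exists>b\<in>I. a p \<ominus> b \<in> F (int p - 1) \<and> (a p = \<zero> \<longrightarrow> b = \<zero>)" for p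
    proof (cases "a p = \<zero>")
      case False
      obtain b f where bf: "b \<in> I" "f \<in> F (int p - 1)" "a p = b \<oplus> f"
        using a(2)[of p] unfolding set_add_def' by blast
      have "b \<in> carrier A" using bf(1) I.a_subset by auto
      then have "a p \<ominus> b = f" using bf(2,3) by (simp add: minus_eq a_comm[of b] a_assoc r_neg)
      then show ?thesis using bf False by blast
    qed (auto intro!: bexI[of _ \<zero>] simp: minus_eq)
    then obtain b where b: "\<And>p. b p \<in> I" "\<And>p. a p \<ominus> b p \<in> F (int p - 1)" "\<And>p. a p = \<zero> \<Longrightarrow> b p = \<zero>"
      by metis
    have bc: "b p \<in> carrier A" for p using b(1) I.a_subset by auto
    \<comment> \<open>Membership of b p in F p is recovered from b p = a p - (a p - b p), where both
      terms on the right lie in F p.\<close>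
    have "b p \<in> F (int p)" for p
    proof -
      have "a p \<ominus> b p \<in> F (int p)" using b(2)[of p] by (rule filt_mono) simp
      then have "a p \<ominus> (a p \<ominus> b p) \<in> F (int p)"
        by (rule filt_minus[OF reesD(1)[OF a(1)]])
      moreover have "a p \<ominus> (a p \<ominus> b p) = b p"
        using a(1) bc[of p] by (simp add: minus_eq minus_add r_neg1 a_assoc[symmetric] r_neg)
      ultimately show ?thesis by simp
    qed
    moreover have "{p. b p \<noteq> \<zero>} \<subseteq> {p. a p \<noteq> \<zero>}" using b(3) by blast
    ultimately have br: "b \<in> rees" unfolding rees_def using reesD(2)[OF a(1)] finite_subset by blast
    then have "cls a = cls b" using cls_eq_iff[OF a(1)] b(2) by blast
    then show "cls a \<in> cls ` {a \<in> rees. \<forall>p. a p \<in> I}" using br b(1) by auto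
  next
    fix a assume "a \<in> {a \<in> rees. \<forall>p. a p \<in> I}"
    then have a: "a \<in> rees" "\<And>p. a p \<in> I" by auto
    have "a p \<oplus> \<zero> \<in> I <+> F (int p - 1)" for p
      unfolding set_add_def' using a(2) filt_zero by blast
    then show "cls a \<in> cls ` {a \<in> rees. \<forall>p. a p \<in> ?L p}" using a reesD(1) by auto
  qed
  finally show ?thesis .
qed

lemma left_ideal_gr_ideal: "left_ideal (gr_ideal A R n x I) G"
  unfolding left_ideal_def
proof (intro conjI ballI additive_subgroupI)
  show "subgroup (gr_ideal A R n x I) (add_monoid G)"
  proof (rule GR.add.subgroupI)
    show "gr_ideal A R n x I \<subseteq> carrier G" by (auto simp: gr_ideal_eq carrier_Gr)
    show "gr_ideal A R n x I \<noteq> {}" using rees_zero by (auto simp: gr_ideal_eq)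
    fix u assume "u \<in> gr_ideal A R n x I"
    then obtain a where a: "a \<in> rees" "\<And>p. a p \<in> I" "u = cls a" by (auto simp: gr_ideal_eq)
    then show "\<ominus>\<^bsub>G\<^esub> u \<in> gr_ideal A R n x I" using rees_neg[of a] by (auto simp: gr_ideal_eq neg_Gr)
    fix v assume "v \<in> gr_ideal A R n x I"
    then obtain b where b: "b \<in> rees" "\<And>p. b p \<in> I" "v = cls b" by (auto simp: gr_ideal_eq)
    then show "u \<oplus>\<^bsub>G\<^esub> v \<in> gr_ideal A R n x I" using a rees_add[of a b] by (auto simp: gr_ideal_eq add_Gr)
  qed
next
  fix u v assume "u \<in> carrier G" "v \<in> gr_ideal A R n x I"
  then obtain a b where ab: "a \<in> rees" "b \<in> rees" "\<And>p. b p \<in> I" "u = cls a" "v = cls b"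
    by (auto simp: gr_ideal_eq carrier_Gr)
  have mult: "a i \<otimes> b j \<in> I" for i j using I ab(1,3) by (simp add: left_ideal_def)
  have fin: "finite B \<Longrightarrow> (\<Oplus>i\<in>B. a i \<otimes> b (p - i)) \<in> I" for B p
    by (induction B rule: finite_induct) (use ab mult in \<open>auto simp: finsum_insert\<close>)
  show "u \<otimes>\<^bsub>G\<^esub> v \<in> gr_ideal A R n x I"
    using ab rees_mult[OF ab(1,2)] fin by (auto simp: gr_ideal_eq mult_Gr)
qed

lemma symb_gr_ideal:
  assumes "f \<in> I" "f \<noteq> \<zero>"
  shows "symb A R n x f \<in> gr_ideal A R n x I"
proof -
  have "f \<in> carrier A" using assms(1) I.a_subset by auto
  then show ?thesis
    using gr_elt_cls[OF pbw_deg_filt(1)] assms by (auto simp: symb_def gr_ideal_eq)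
qed

lemma reducible_gr:
  assumes S: "monomial_order A R n x S" and B: "B \<subseteq> I - {\<zero>}"
    and red: "\<And>f. f \<in> I \<Longrightarrow> f \<noteq> \<zero> \<Longrightarrow> reducible A R n x S B f"
    and u: "u \<in> gr_ideal A R n x I" "u \<noteq> \<zero>\<^bsub>G\<^esub>"
  shows "reducible G Gbase n Gvars (gr_order A R n x S) (symb A R n x ` B) u"
proof -
  obtain a where a: "a \<in> rees" "\<And>p. a p \<in> I" "u = cls a" using u(1) by (auto simp: gr_ideal_eq)
  \<comment> \<open>The top degree is taken over nonzero classes: a representative may be nonzero in
    a higher degree where its class vanishes.\<close>
  let ?P = "{p. a p \<notin> F (int p - 1)}"
  have fin: "finite ?P" using reesD(2)[OF a(1)] by (rule rev_finite_subset) auto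
  have "?P \<noteq> {}"
  proof
    assume "?P = {}"
    then have "cls a = cls (\<lambda>_. \<zero>)" using a(1) by (subst cls_eq_iff) (auto simp: rees_zero minus_eq)
    then show False using u(2) a(3) by (simp add: cls_zero)
  qed
  define p where "p = Max ?P"
  have p: "a p \<notin> F (int p - 1)" using Max_in[OF fin \<open>?P \<noteq> {}\<close>] by (simp add: p_def)
  have top: "\<forall>q>p. a q \<in> F (int q - 1)"
    using Max_ge[OF fin] by (fastforce simp: p_def)
  note lead = lead_cls[OF S a(1) p top]
  have f: "a p \<in> I" "a p \<noteq> \<zero>" using a(2) p by auto
  obtain t :: nat and h \<alpha> where t: "t \<ge> 1"
    "\<forall>j\<in>{1..t}. h j \<in> B \<and> \<alpha> j \<in> mexps n \<and>
      madd (\<alpha> j) (mexp A n x (lm A R n x S (h j))) = mexp A n x (lm A R n x S (a p))"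
    "lc A R n x S (a p) \<in> gen_left_ideal (A\<lparr>carrier := R\<rparr>)
      ((\<lambda>j. pbw_sigma A R n x (\<alpha> j) (lc A R n x S (h j)) \<otimes>
        pbw_c A R n x (\<alpha> j) (mexp A n x (lm A R n x S (h j)))) ` {1..t})" (is "_ \<in> gen_left_ideal _ (?w ` _)")
    using red[OF f] unfolding reducible_def by blast
  have h: "h j \<in> carrier A" "h j \<noteq> \<zero>" "\<alpha> j \<in> mexps n" if "j \<in> {1..t}" for j
    using t(2) that B I.a_subset by blast+
  let ?S = "gr_order A R n x S" and ?h = "\<lambda>j. symb A R n x (h j)"
  let ?w' = "\<lambda>j. pbw_sigma G Gbase n Gvars (\<alpha> j) (lc G Gbase n Gvars ?S (?h j)) \<otimes>\<^bsub>G\<^esub>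
        pbw_c G Gbase n Gvars (\<alpha> j) (mexp G n Gvars (lm G Gbase n Gvars ?S (?h j)))"
  \<comment> \<open>Each generator built from symbols is the image of the corresponding generator in
    R, since sigma, c, leading coefficients and exponents all transfer.\<close>
  have w: "?w j \<in> R \<and> ?w' j = base_emb (?w j)" if "j \<in> {1..t}" for j
    using pbw_sigma_Gr[OF h(3)[OF that], of "lc A R n x S (h j)"] pbw_c_Gr[OF h(3)[OF that]]
      lead_symb[OF S h(1,2)[OF that]] lc_mexp_closed[OF S h(1,2)[OF that]]
    by (simp add: base_emb_simps R_closed)
  have "?w' ` {1..t} = base_emb ` ?w ` {1..t}" unfolding image_image using w by (intro image_cong) auto
  moreover have "base_emb (lc A R n x S (a p)) \<in> gen_left_ideal (G\<lparr>carrier := Gbase\<rparr>) (base_emb ` ?w ` {1..t})"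
    using w t(3) lc_mexp_closed(1)[OF S rees_carrier[OF a(1)] f(2)] by (intro gen_left_ideal_base_emb) auto
  ultimately have lc: "lc G Gbase n Gvars ?S u \<in> gen_left_ideal (G\<lparr>carrier := Gbase\<rparr>) (?w' ` {1..t})"
    unfolding a(3) lead(2) by simp
  have div: "?h j \<in> symb A R n x ` B \<and> \<alpha> j \<in> mexps n \<and>
      madd (\<alpha> j) (mexp G n Gvars (lm G Gbase n Gvars ?S (?h j))) = mexp G n Gvars (lm G Gbase n Gvars ?S u)"
    if "j \<in> {1..t}" for j
    unfolding a(3) lead(1) using bspec[OF t(2) that] lead_symb(1)[OF S h(1,2)[OF that]] by simp
  show ?thesis
    unfolding reducible_def
    by (intro exI[of _ t] exI[of _ ?h] exI[of _ \<alpha>] conjI ballI t(1) lc div)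
qed

end

theorem groebner_basis_symb:
  assumes B: "groebner_basis A R n x S I B"
  shows "groebner_basis G Gbase n Gvars (gr_order A R n x S) (gr_ideal A R n x I) (symb A R n x ` B)"
proof -
  have S: "monomial_order A R n x S" and I: "left_ideal I A" and fin: "finite B" "B \<noteq> {}"
    and BI: "B \<subseteq> I - {\<zero>}" and red: "\<And>f. f \<in> I \<Longrightarrow> f \<noteq> \<zero> \<Longrightarrow> reducible A R n x S B f"
    using B unfolding groebner_basis_def by auto
  have IA: "I \<subseteq> carrier A" using I additive_subgroup.a_subset by (auto simp: left_ideal_def)
  have sub: "symb A R n x ` B \<subseteq> gr_ideal A R n x I - {\<zero>\<^bsub>G\<^esub>}"
    using BI IA symb_gr_ideal[OF I] symb_nonzero by auto
  then have "gr_ideal A R n x I \<noteq> {\<zero>\<^bsub>G\<^esub>}" using fin(2) by auto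
  then show ?thesis
    unfolding groebner_basis_def
    using skew_PBW_Gr monomial_order_gr_order[OF S] left_ideal_gr_ideal[OF I] sub fin
      reducible_gr[OF I S BI red] by auto
qed

end

text \<open>A nonzero f in I excludes 1 = 0, because f = 1 f.\<close>

lemma skew_PBW_nontrivialI:
  assumes "skew_PBW A R n x" "left_ideal I A" "I \<noteq> {\<zero>\<^bsub>A\<^esub>}"
  shows "nontrivial_skew_PBW A R n x"
proof -
  interpret skew_PBW A R n x by (rule assms(1))
  interpret additive_subgroup I A using assms(2) by (simp add: left_ideal_def)
  obtain f where f: "f \<in> carrier A" "f \<noteq> \<zero>\<^bsub>A\<^esub>" using assms(3) zero_closed a_subset by blast
  then have "\<one>\<^bsub>A\<^esub> \<noteq> \<zero>\<^bsub>A\<^esub>" using l_one l_null by metis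
  then show ?thesis using assms(1) by (simp add: nontrivial_skew_PBW_def nontrivial_skew_PBW_axioms_def)
qed

theorem theorem3p15:
  fixes A :: "('a, 'm) ring_scheme" and R :: "'a set" and n :: nat and x :: "nat \<Rightarrow> 'a"
    and S :: "('a \<times> 'a) set" and I :: "'a set" and J :: "'j set" and g :: "'j \<Rightarrow> 'a"
  assumes "skew_PBW A R n x"
    and "monomial_order A R n x S"
    and "left_ideal I A" and "I \<noteq> {\<zero>\<^bsub>A\<^esub>}"
    and "groebner_basis A R n x S I (g ` J)"
  shows "groebner_basis (Gr A R n x) (gr_base A R n x) n (gr_vars A R n x) (gr_order A R n x S)
           (gr_ideal A R n x I) ((\<lambda>i. symb A R n x (g i)) ` J) \<and>
         (\<forall>i\<in>J. homogeneous A R n x (symb A R n x (g i)))"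
proof -
  interpret nontrivial_skew_PBW A R n x
    by (rule skew_PBW_nontrivialI[OF assms(1,3,4)])
  have "g ` J \<subseteq> I - {\<zero>\<^bsub>A\<^esub>}" using assms(5) by (simp add: groebner_basis_def)
  moreover have "I \<subseteq> carrier A"
    using assms(3) additive_subgroup.a_subset by (auto simp: left_ideal_def)
  ultimately have "\<forall>i\<in>J. g i \<in> carrier A \<and> g i \<noteq> \<zero>\<^bsub>A\<^esub>" by auto
  then show ?thesis using groebner_basis_symb[OF assms(5)] homogeneous_symb by (simp add: image_image)
qed

end
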